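(* Let $(E,\mu,\Gamma)$ be a Markov diffusion triple satisfying the $CD(\rho,n)$ condition with $\rho\in\mathbb{R}\setminus\{0\}$ and $n\geq1$. Then for any positive function $f\in\mathcal A$ and any $t>0$, $$\frac{\Gamma(P_tf)}{(P_tf)^2}<\frac n2\,\Phi_t\left(\frac{4}{n\rho}\frac{LP_tf}{P_tf}\right),$$ where $$\Phi_t(x)=\begin{cases}\dfrac{\rho}{2}\left(x-2+2\sqrt{1-x}\,\coth(\rho t\sqrt{1-x})\right), & x\leq 1,\\[2mm] \dfrac{\rho}{2}\left(x-2+2\sqrt{x-1}\,\cot(\rho t\sqrt{x-1})\right), & 1\leq x<1+\dfrac{\pi^2}{\rho^2t^2}.\end{cases}$$
   Context: A Markov diffusion triple $(E,\mu,\Gamma)$ (in the sense of Bakry--Gentil--Ledoux, Analysis and Geometry of Markov Diffusion Operators, Chapter 3) consists of a nice state space $E$ equipped with a Markov diffusion semigroup $(P_t)_{t\geq 0}$ with infinitesimal generator $L$, carr\'e du champ $\Gamma$, and an invariant and reversible $\sigma$-finite measure $\mu$. There is a suitable algebra $\mathcal A$ of functions from $E$ to $\mathbb{R}$ on which, pointwise, $$\Gamma(f,g)=\tfrac12\big(L(fg)-fLg-gLf\big),\qquad \Gamma(f)=\Gamma(f,f),\qquad \Gamma_2(f)=\tfrac12\big(L\Gamma(f)-2\Gamma(f,Lf)\big).$$ The generator satisfies the diffusion property $L\phi(f)=\phi'(f)Lf+\phi''(f)\Gamma(f)$ for every smooth $\phi$ and $f\in\mathcal A$. The main example is a smooth,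 connected, complete weighted Riemannian manifold $M$ with $L=\Delta+\nabla V\cdot\nabla$, $d\mu=e^Vdx$, $\Gamma(f)=|\nabla f|^2$ and $\mathcal A$ the smooth bounded functions. The curvature-dimension condition $CD(\rho,n)$ means: $\Gamma_2(f)\geq\rho\,\Gamma(f)+\frac1n(Lf)^2$ for all $f\in\mathcal A$. Inequalities are pointwise on $E$. The value $\Phi_t(1)=\frac1t-\frac\rho2$ is defined by continuity. Under the hypotheses one always has $\frac{4}{n\rho}\frac{LP_tf}{P_tf}<1+\frac{\pi^2}{\rho^2t^2}$, so the right-hand side is well defined. *)

theory Defs
  imports "HOL-Probability.Probability"
begin

definition smooth_fun_on :: "real set \<Rightarrow> (real \<Rightarrow> real) \<Rightarrow> bool" where
  "smooth_fun_on U \<phi> \<longleftrightarrow> open U \<and> (\<forall>k. (deriv ^^ k) \<phi> differentiable_on U)"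

definition semigroup_op ::
    "(real \<Rightarrow> 'a \<Rightarrow> 'a measure) \<Rightarrow> real \<Rightarrow> ('a \<Rightarrow> real) \<Rightarrow> 'a \<Rightarrow> real" where
  "semigroup_op p t f x = (\<integral>y. f y \<partial>p t x)"

definition carre_du_champ ::
    "(('a \<Rightarrow> real) \<Rightarrow> 'a \<Rightarrow> real) \<Rightarrow> ('a \<Rightarrow> real) \<Rightarrow> ('a \<Rightarrow> real) \<Rightarrow> 'a \<Rightarrow> real" where
  "carre_du_champ L f g x = (1/2) * (L (\<lambda>y. f y * g y) x - f x * L g x - g x * L f x)"

definition Gamma2 :: "(('a \<Rightarrow> real) \<Rightarrow> 'a \<Rightarrow> real) \<Rightarrow> ('a \<Rightarrow> real) \<Rightarrow> 'a \<Rightarrow> real" where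
  "Gamma2 L f x = (1/2) * (L (carre_du_champ L f f) x - 2 * carre_du_champ L f (L f) x)"

text \<open>
  The state space is the whole type \<^typ>\<open>'a\<close>, and the semigroup is given by its transition
  kernels \<open>p t x\<close>. They are probability measures, so that \<open>P\<^sub>t 1 = 1\<close>. Times are reals, and only
  \<open>t \<ge> 0\<close> is constrained.
\<close>

locale reversible_markov_semigroup = sigma_finite_measure \<mu>
  for \<mu> :: "'a measure" +
  fixes p :: "real \<Rightarrow> 'a \<Rightarrow> 'a measure"
  assumes space_eq_UNIV: "space \<mu> = UNIV"
    and kernel: "0 \<le> t \<Longrightarrow> p t \<in> measurable \<mu> (prob_algebra \<mu>)"
    and kernel_0: "p 0 x = return \<mu> x"
    and chapman_kolmogorov: "0 \<le> s \<Longrightarrow> 0 \<le> t \<Longrightarrow> p (s + t) x = bind (p s x) (p t)"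
    and invariant:
      "0 \<le> t \<Longrightarrow> f \<in> borel_measurable \<mu> \<Longrightarrow>
        (\<integral>\<^sup>+x. (\<integral>\<^sup>+y. f y \<partial>p t x) \<partial>\<mu>) = (\<integral>\<^sup>+x. f x \<partial>\<mu>)"
    and reversible:
      "0 \<le> t \<Longrightarrow> f \<in> borel_measurable \<mu> \<Longrightarrow> g \<in> borel_measurable \<mu> \<Longrightarrow>
        (\<integral>\<^sup>+x. f x * (\<integral>\<^sup>+y. g y \<partial>p t x) \<partial>\<mu>) = (\<integral>\<^sup>+x. g x * (\<integral>\<^sup>+y. f y \<partial>p t x) \<partial>\<mu>)"
    and L2_continuous:
      "h \<in> borel_measurable \<mu> \<Longrightarrow> integrable \<mu> (\<lambda>x. (h x)\<^sup>2) \<Longrightarrow>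
        ((\<lambda>t. \<integral>\<^sup>+x. ennreal ((semigroup_op p t h x - h x)\<^sup>2) \<partial>\<mu>) \<longlongrightarrow> 0) (at_right 0)"

text \<open>
  \<open>\<D>\<close> is the class on which the generator \<open>L\<close>, and hence also the carre du champ and its iterate,
  is defined pointwise; on a weighted manifold, it consists of all smooth functions. \<open>L\<close> need not
  preserve boundedness (its coefficients may be unbounded), so the algebra of the bounded
  functions of \<open>\<D>\<close>, on which the semigroup acts, is kept separate.
\<close>

definition bounded_algebra :: "('a \<Rightarrow> real) set \<Rightarrow> ('a \<Rightarrow> real) set" where
  "bounded_algebra \<D> = {f \<in> \<D>. bounded (range f)}"

text \<open>
  In the diffusion property, \<open>\<phi>\<close> needs to be smooth only on an open set that contains the values
  of \<open>f\<close>, for instance \<open>ln\<close> for a positive \<open>f\<close>.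

  In \<open>commute\<close>, the lower bound gives \<open>P\<^sub>t (L f)\<close> a meaning, because \<open>L f\<close> need not be bounded.

  The assumption \<open>regularizing\<close> is qualitative: the constant \<open>C\<close> is arbitrary, and nothing is
  required as \<open>t\<close> tends to \<open>0\<close> or to infinity. It makes the state space ``nice'': on an incomplete
  manifold (e.g. a flat cone of total angle greater than \<open>2 * pi\<close> without its vertex), the
  curvature-dimension condition alone does not keep the gradient of \<open>P\<^sub>t f\<close> bounded. Positivity of the carre du
  champ on the algebra is not listed because it follows from \<open>generator\<close> at time \<open>0\<close> and from
  \<open>p t x\<close> being a probability measure.
\<close>

locale markov_diffusion_triple = reversible_markov_semigroup \<mu> p
  for \<mu> :: "'a measure" and p :: "real \<Rightarrow> 'a \<Rightarrow> 'a measure" +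
  fixes \<D> :: "('a \<Rightarrow> real) set"
    and L :: "('a \<Rightarrow> real) \<Rightarrow> 'a \<Rightarrow> real"
  assumes D_measurable: "\<D> \<subseteq> borel_measurable \<mu>"
    and D_const: "(\<lambda>x. c) \<in> \<D>"
    and D_add: "f \<in> \<D> \<Longrightarrow> g \<in> \<D> \<Longrightarrow> (\<lambda>x. f x + g x) \<in> \<D>"
    and D_mult: "f \<in> \<D> \<Longrightarrow> g \<in> \<D> \<Longrightarrow> (\<lambda>x. f x * g x) \<in> \<D>"
    and D_smooth:
      "f \<in> \<D> \<Longrightarrow> smooth_fun_on U \<phi> \<Longrightarrow> range f \<subseteq> U \<Longrightarrow> (\<lambda>x. \<phi> (f x)) \<in> \<D>"
    and D_L: "f \<in> \<D> \<Longrightarrow> L f \<in> \<D>"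
    and L_add: "f \<in> \<D> \<Longrightarrow> g \<in> \<D> \<Longrightarrow> L (\<lambda>x. f x + g x) x = L f x + L g x"
    and L_scale: "f \<in> \<D> \<Longrightarrow> L (\<lambda>x. c * f x) x = c * L f x"
    and diffusion:
      "f \<in> \<D> \<Longrightarrow> smooth_fun_on U \<phi> \<Longrightarrow> range f \<subseteq> U \<Longrightarrow>
        L (\<lambda>y. \<phi> (f y)) x =
          deriv \<phi> (f x) * L f x + deriv (deriv \<phi>) (f x) * carre_du_champ L f f x"
    and semigroup_closed:
      "f \<in> bounded_algebra \<D> \<Longrightarrow> 0 \<le> t \<Longrightarrow> semigroup_op p t f \<in> bounded_algebra \<D>"
    and generator:
      "f \<in> bounded_algebra \<D> \<Longrightarrow> 0 \<le> t \<Longrightarrow>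
        ((\<lambda>s. semigroup_op p s f x) has_real_derivative L (semigroup_op p t f) x)
          (at t within {0..})"
    and commute:
      "f \<in> bounded_algebra \<D> \<Longrightarrow> bdd_below (range (L f)) \<Longrightarrow> 0 \<le> t \<Longrightarrow>
        integrable (p t x) (L f) \<and> L (semigroup_op p t f) x = semigroup_op p t (L f) x"
    and regularizing:
      "f \<in> bounded_algebra \<D> \<Longrightarrow> 0 < a \<Longrightarrow>
        \<exists>C. \<forall>t\<in>{a..b}. \<forall>x. \<bar>L (semigroup_op p t f) x\<bar> \<le> C \<and>
          carre_du_champ L (semigroup_op p t f) (semigroup_op p t f) x \<le> C"

definition curvature_dimension ::
    "('a \<Rightarrow> real) set \<Rightarrow> (('a \<Rightarrow> real) \<Rightarrow> 'a \<Rightarrow> real) \<Rightarrow> real \<Rightarrow> real \<Rightarrow> bool" where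
  "curvature_dimension \<D> L \<rho> n \<longleftrightarrow>
    (\<forall>f\<in>bounded_algebra \<D>. \<forall>x.
      Gamma2 L f x \<ge> \<rho> * carre_du_champ L f f x + (1 / n) * (L f x)\<^sup>2)"

definition coth :: "real \<Rightarrow> real" where
  "coth x = cosh x / sinh x"

text \<open>
  The value at \<open>x = 1\<close>, where \<open>coth\<close> and \<open>cot\<close> have a pole, is the common limit of both formulas.
  Only arguments \<open>x < 1 + pi\<^sup>2 / (\<rho>\<^sup>2 * t\<^sup>2)\<close> are meaningful.
\<close>

definition Phi :: "real \<Rightarrow> real \<Rightarrow> real \<Rightarrow> real" where
  "Phi \<rho> t x =
    (if x < 1 then \<rho> / 2 * (x - 2 + 2 * sqrt (1 - x) * coth (\<rho> * t * sqrt (1 - x)))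
     else if x = 1 then 1 / t - \<rho> / 2
     else \<rho> / 2 * (x - 2 + 2 * sqrt (x - 1) * cot (\<rho> * t * sqrt (x - 1))))"

end

theory Submission
  imports Defs
begin

text \<open>
  Fix a positive bounded \<open>f\<close>, a time \<open>t\<close> and a point \<open>x\<close>, and follow, for \<open>0 \<le> s < t\<close>, the entropy
  and the Fisher information of \<open>v = P\<^bsub>t - s\<^esub> f\<close> under the probability measure \<open>p s x\<close>:
  \<open>H s = P\<^sub>s (v * ln v) x / P\<^sub>t f x\<close> and \<open>\<lambda> s = P\<^sub>s (\<Gamma>(v) / v) x / P\<^sub>t f x\<close>. The diffusion
  property gives \<open>H' = \<lambda>\<close>, and a Bochner computation
  gives \<open>\<lambda>' = 2 * P\<^sub>s (v * \<Gamma>\<^sub>2(ln v)) x / P\<^sub>t f x\<close>. With \<open>X = L P\<^sub>t f x / P\<^sub>t f x\<close>, the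
  curvature-dimension condition and the Cauchy-Schwarz inequality turn the second identity into the
  Riccati inequality \<open>\<lambda>' \<ge> 2 * \<rho> * \<lambda> + 2 / n * (X - \<lambda>)\<^sup>2\<close>
  (lemma \<open>fisher_information_derivative\<close>). Its solutions blow up before time \<open>t\<close> when \<open>\<lambda> 0\<close>, which is
  \<open>\<Gamma>(P\<^sub>t f) / (P\<^sub>t f)\<^sup>2\<close> at \<open>x\<close>, is too large, and for large \<open>\<rho> * X\<close> they blow up whatever \<open>\<lambda> 0\<close> is;
  the function \<open>\<Phi>\<^sub>t\<close> records the blow-up threshold.

  The strict inequality comes from the entropy. The substitution
  \<open>y s = exp (- 2 / n * (H s - H 0 + (n * \<rho> / 2 - X) * s))\<close> linearizes the Riccati inequality to
  \<open>y'' \<le> (\<rho>\<^sup>2 - 4 * \<rho> / n * X) * y\<close>. As \<open>v\<close> is bounded, \<open>H\<close> is bounded, so \<open>y\<close> stays away from \<open>0\<close> up to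
  time \<open>t\<close>. Comparison with a solution \<open>S\<close> of the linear equation that vanishes at \<open>t\<close> (a
  \<open>sinh\<close>, an affine function or a \<open>sin\<close>) then yields
  \<open>S' 0 + 2 / n * (\<lambda> 0 + n * \<rho> / 2 - X) * S 0 < 0\<close>, which is the claim; a \<open>sin\<close> with
  zeros at \<open>0\<close> and at a time \<open>T \<le> t\<close> would contradict this, which bounds \<open>\<rho> * X\<close>.

  Two points need care. First, \<open>ln v\<close> is sure to be bounded only if \<open>f\<close> is bounded away from \<open>0\<close>. Therefore
  \<open>f\<close> is replaced by \<open>f + e\<close>, and the comparison (lemma \<open>sturm_comparison\<close>) is quantitative, so
  that its strict conclusion survives the limit \<open>e \<rightarrow> 0\<close> (lemma \<open>riccati_bound\<close>). Secondly, \<open>L\<close> and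
  \<open>\<Gamma>\<close> carry no continuity, so that \<open>\<Gamma>(P\<^sub>r f)\<close> cannot simply be differentiated in \<open>r\<close>.
  What helps is that \<open>L g\<close> is the limit of the difference quotients \<open>(P\<^sub>\<tau> g - g) / \<tau>\<close>, which do
  commute with derivatives in \<open>r\<close>; estimates uniform in \<open>\<tau>\<close> then pass to \<open>L\<close>
  (lemma \<open>uniform_curve_L\<close>). They need bounds on \<open>L\<^sup>k P\<^sub>r f\<close> and on its carre du champ for small \<open>k\<close>, which
  follow by splitting \<open>P\<^sub>r\<close> (lemma \<open>iterated_generator_smoothing\<close>).
\<close>

section \<open>One-variable calculus and a Sturm comparison\<close>

lemma quadratic_remainder_imp_derivative:
  fixes q :: "real \<Rightarrow> real"
  assumes "\<And>s. s \<in> I \<Longrightarrow> \<bar>q s - q r - (s - r) * d\<bar> \<le> C * (s - r)\<^sup>2"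
  shows "(q has_real_derivative d) (at r within I)"
proof -
  have "((\<lambda>s. (q s - q r) / (s - r) - d) \<longlongrightarrow> 0) (at r within I)"
  proof (rule Lim_null_comparison)
    show "((\<lambda>s. \<bar>C\<bar> * \<bar>s - r\<bar>) \<longlongrightarrow> 0) (at r within I)"
      by (auto intro!: tendsto_eq_intros)
    show "\<forall>\<^sub>F s in at r within I. norm ((q s - q r) / (s - r) - d) \<le> \<bar>C\<bar> * \<bar>s - r\<bar>"
      unfolding eventually_at_filter
    proof (intro always_eventually allI impI)
      fix s assume s: "s \<noteq> r" "s \<in> I"
      have "norm ((q s - q r) / (s - r) - d) = \<bar>q s - q r - (s - r) * d\<bar> / \<bar>s - r\<bar>"
        using s by (simp add: abs_divide[symmetric] diff_divide_distrib)
      also have "\<dots> \<le> (C * (s - r)\<^sup>2) / \<bar>s - r\<bar>"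
        using assms s by (intro divide_right_mono) auto
      also have "\<dots> = C * \<bar>s - r\<bar>"
        using s by (subst power2_abs[symmetric]) (simp add: power2_eq_square del: abs_mult_self_eq)
      also have "\<dots> \<le> \<bar>C\<bar> * \<bar>s - r\<bar>"
        by (intro mult_right_mono) auto
      finally show "norm ((q s - q r) / (s - r) - d) \<le> \<bar>C\<bar> * \<bar>s - r\<bar>" .
    qed
  qed
  then show ?thesis
    unfolding has_field_derivative_iff by (simp add: LIM_zero_iff)
qed

lemma quadratic_taylor_remainder:
  fixes q q' q'' :: "real \<Rightarrow> real"
  assumes q: "\<And>r. r \<in> {a..b} \<Longrightarrow> (q has_real_derivative q' r) (at r within {a..b})"
    and q': "\<And>r. r \<in> {a..b} \<Longrightarrow> (q' has_real_derivative q'' r) (at r within {a..b})"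
    and C: "\<And>r. r \<in> {a..b} \<Longrightarrow> \<bar>q'' r\<bar> \<le> C"
    and rs: "r \<in> {a..b}" "s \<in> {a..b}"
  shows "\<bar>q s - q r - (s - r) * q' r\<bar> \<le> C * (s - r)\<^sup>2"
proof -
  have sub: "closed_segment r s \<subseteq> {a..b}"
    using rs by (simp add: closed_segment_eq_real_ivl)
  have 1: "\<bar>q' z - q' r\<bar> \<le> C * \<bar>z - r\<bar>" if "z \<in> {a..b}" for z
    using field_differentiable_bound[of "{a..b}" q' q'' C z r] q' C rs that by simp
  have C0: "C \<ge> 0"
    using C[OF rs(1)] by linarith
  have "norm ((q s - s * q' r) - (q r - r * q' r)) \<le> (C * \<bar>s - r\<bar>) * norm (s - r)"
  proof (rule field_differentiable_bound[where S = "closed_segment r s" and f' = "\<lambda>z. q' z - q' r"])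
    fix z assume z: "z \<in> closed_segment r s"
    have zab: "z \<in> {a..b}"
      using z sub by blast
    show "((\<lambda>z. q z - z * q' r) has_real_derivative q' z - q' r) (at z within closed_segment r s)"
      by (rule derivative_eq_intros DERIV_subset[OF q[OF zab] sub] refl | simp)+
    have "\<bar>z - r\<bar> \<le> \<bar>s - r\<bar>"
      using z by (auto simp: closed_segment_eq_real_ivl split: if_splits)
    then show "norm (q' z - q' r) \<le> C * \<bar>s - r\<bar>"
      using 1[OF zab] mult_left_mono[OF _ C0] by (force intro: order_trans)
  qed auto
  moreover have "(q s - s * q' r) - (q r - r * q' r) = q s - q r - (s - r) * q' r"
    by (simp add: algebra_simps)
  ultimately show ?thesis
    by (simp add: power2_eq_square mult.assoc)
qed

lemma derivative_ge_imp_growth: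
  fixes f f' :: "real \<Rightarrow> real"
  assumes "\<And>s. s \<in> {0..<T} \<Longrightarrow> (f has_real_derivative f' s) (at s within {0..<T})"
    and "\<And>s. s \<in> {0..<T} \<Longrightarrow> k \<le> f' s"
    and s: "s \<in> {0..<T}"
  shows "f 0 + k * s \<le> f s"
proof -
  have "\<exists>z\<in>{0..s}. f s - f 0 = f' z * (s - 0)"
  proof (rule mvt_very_simple)
    fix z assume "0 \<le> z" "z \<le> s"
    then show "(f has_derivative (*) (f' z)) (at z within {0..s})"
      using s assms(1)[of z] by (auto simp: has_field_derivative_def intro: has_derivative_subset)
  qed (use s in auto)
  then obtain z where z: "z \<in> {0..s}" "f s - f 0 = f' z * s"
    by auto
  moreover have "k * s \<le> f' z * s"
    using assms(2)[of z] z s by (intro mult_right_mono) auto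
  ultimately show ?thesis
    by linarith
qed

text \<open>
The Wronskian \<open>W = y * S' - y' * S\<close> decreases by at most \<open>\<delta> * M * K * T\<close>, hence stays above \<open>d\<close>, and
\<open>W / y\<^sup>2\<close> is the derivative of \<open>S / y\<close>. As \<open>y\<close> is bounded below, \<open>S / y\<close> tends to \<open>0\<close> at \<open>T\<close>, which is
incompatible with too large a \<open>d\<close>. The error \<open>\<delta>\<close> and the explicit constants make the conclusion stable
under limits.
\<close>

lemma sturm_comparison:
  fixes y y' y'' S S' :: "real \<Rightarrow> real"
  assumes T: "0 < T"
    and y: "\<And>s. s \<in> {0..<T} \<Longrightarrow> (y has_real_derivative y' s) (at s within {0..<T})"
    and y': "\<And>s. s \<in> {0..<T} \<Longrightarrow> (y' has_real_derivative y'' s) (at s within {0..<T})"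
    and y'': "\<And>s. s \<in> {0..<T} \<Longrightarrow> y'' s \<le> (c + \<delta>) * y s"
    and m: "0 < m" and bounds: "\<And>s. s \<in> {0..<T} \<Longrightarrow> m \<le> y s \<and> y s \<le> M"
    and \<delta>: "0 \<le> \<delta>" and y0: "y 0 = 1"
    and S: "\<And>s. (S has_real_derivative S' s) (at s)"
    and S': "\<And>s. (S' has_real_derivative c * S s) (at s)"
    and S_bounds: "\<And>s. s \<in> {0..T} \<Longrightarrow> 0 \<le> S s \<and> S s \<le> K" and ST: "S T = 0"
  defines "d \<equiv> S' 0 - y' 0 * S 0 - \<delta> * M * K * T"
  shows "S 0 + min (d / M\<^sup>2) (d / m\<^sup>2) * T \<le> 0"
proof -
  define W where "W s = y s * S' s - y' s * S s" for s
  have y_pos: "0 < y s" if "s \<in> {0..<T}" for s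
    using bounds[OF that] m by linarith
  have M: "0 < M" and K: "0 \<le> K"
    using bounds[of 0] S_bounds[of 0] T m by auto
  have W_lower: "d \<le> W s" if s: "s \<in> {0..<T}" for s
  proof -
    have "W 0 + (- (\<delta> * M * K)) * s \<le> W s"
    proof (rule derivative_ge_imp_growth[OF _ _ s])
      fix r assume r: "r \<in> {0..<T}"
      show "(W has_real_derivative c * y r * S r - y'' r * S r) (at r within {0..<T})"
        unfolding W_def
        by (rule derivative_eq_intros y[OF r] y'[OF r] has_field_derivative_at_within[OF S]
              has_field_derivative_at_within[OF S'] refl | simp add: algebra_simps)+
      have "y'' r * S r \<le> ((c + \<delta>) * y r) * S r"
        using y''[OF r] S_bounds[of r] r by (intro mult_right_mono) auto
      moreover have "y r * S r \<le> M * K"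
        using bounds[OF r] S_bounds[of r] r y_pos[OF r] M by (intro mult_mono) auto
      then have "\<delta> * (y r * S r) \<le> \<delta> * (M * K)"
        using \<delta> by (rule mult_left_mono)
      ultimately show "- (\<delta> * M * K) \<le> c * y r * S r - y'' r * S r"
        by (simp add: algebra_simps)
    qed
    moreover have "\<delta> * M * K * s \<le> \<delta> * M * K * T"
      using s \<delta> M K by (intro mult_left_mono) auto
    ultimately show ?thesis
      using y0 by (simp add: W_def d_def)
  qed
  define k where "k = min (d / M\<^sup>2) (d / m\<^sup>2)"
  (* The minimum covers both signs of d, with y\<^sup>2 between m\<^sup>2 and M\<^sup>2. *)
  have quotient: "S 0 + k * s \<le> S s / m" if s: "s \<in> {0..<T}" for s
  proof -
    have "S 0 / y 0 + k * s \<le> S s / y s"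
    proof (rule derivative_ge_imp_growth[OF _ _ s])
      fix r assume r: "r \<in> {0..<T}"
      show "((\<lambda>s. S s / y s) has_real_derivative W r / (y r)\<^sup>2) (at r within {0..<T})"
        unfolding W_def using y_pos[OF r]
        by (auto intro!: derivative_eq_intros y[OF r] has_field_derivative_at_within[OF S]
              simp: field_simps power2_eq_square)
      have "k \<le> d / (y r)\<^sup>2"
      proof (cases "d \<ge> 0")
        case True
        then have "d / M\<^sup>2 \<le> d / (y r)\<^sup>2"
          using bounds[OF r] y_pos[OF r] M by (intro divide_left_mono power_mono mult_pos_pos) auto
        then show ?thesis
          by (simp add: k_def)
      next
        case False
        then have "d / m\<^sup>2 \<le> d / (y r)\<^sup>2"
          using bounds[OF r] y_pos[OF r] m
          by (intro divide_left_mono_neg power_mono mult_pos_pos) auto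
        then show ?thesis
          by (simp add: k_def)
      qed
      also have "\<dots> \<le> W r / (y r)\<^sup>2"
        using W_lower[OF r] by (intro divide_right_mono) auto
      finally show "k \<le> W r / (y r)\<^sup>2" .
    qed
    moreover have "S s / y s \<le> S s / m"
      using bounds[OF s] S_bounds[of s] s m by (intro divide_left_mono) auto
    ultimately show ?thesis
      using y0 by simp
  qed
  have "(S \<longlongrightarrow> S T) (at_left T)"
    using DERIV_isCont[OF S] by (simp add: isCont_def filterlim_at_split)
  then have "((\<lambda>s. S s / m) \<longlongrightarrow> S T / m) (at_left T)"
    by (rule tendsto_divide) (use m in auto)
  moreover have "((\<lambda>s. S 0 + k * s) \<longlongrightarrow> S 0 + k * T) (at_left T)"
    by (intro tendsto_intros)
  moreover have "\<forall>\<^sub>F s in at_left T. S 0 + k * s \<le> S s / m"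
    using eventually_at_left_real[OF T] by eventually_elim (use quotient in auto)
  ultimately have "S 0 + k * T \<le> S T / m"
    by (intro tendsto_le[of "at_left T"]) auto
  then show ?thesis
    by (simp add: ST k_def)
qed

text \<open>
The Riccati inequality is linearized by the exponential of a multiple of \<open>H\<close>, a primitive of \<open>lam\<close>.
The bounds \<open>m\<close> and \<open>M\<close> on that exponential do not depend on \<open>e\<close>, so the comparison
passes to the limit \<open>e \<rightarrow> 0\<close> with a gap that keeps the final inequality strict. Since \<open>S\<close> solves the limit
equation, the differences \<open>X e - X0\<close> enter as the error \<open>\<delta>\<close>.
\<close>

lemma riccati_bound:
  fixes H lam lam' :: "real \<Rightarrow> real \<Rightarrow> real" and X S S' :: "real \<Rightarrow> real"
  assumes T: "0 < T" "T \<le> t" and n: "0 < n"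
    and H: "\<And>e s. 0 < e \<Longrightarrow> e \<le> 1 \<Longrightarrow> s \<in> {0..<t} \<Longrightarrow>
      (H e has_real_derivative lam e s) (at s within {0..<t})"
    and lam: "\<And>e s. 0 < e \<Longrightarrow> e \<le> 1 \<Longrightarrow> s \<in> {0..<t} \<Longrightarrow>
      (lam e has_real_derivative lam' e s) (at s within {0..<t})"
    and riccati: "\<And>e s. 0 < e \<Longrightarrow> e \<le> 1 \<Longrightarrow> s \<in> {0..<t} \<Longrightarrow>
      lam' e s \<ge> 2 * \<rho> * lam e s + 2 / n * (X e - lam e s)\<^sup>2"
    and H_bound: "\<And>e s. 0 < e \<Longrightarrow> e \<le> 1 \<Longrightarrow> s \<in> {0..<t} \<Longrightarrow> \<bar>H e s\<bar> \<le> B"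
    and X_bound: "\<And>e. 0 < e \<Longrightarrow> e \<le> 1 \<Longrightarrow> \<bar>X e\<bar> \<le> A"
    and X_lim: "(X \<longlongrightarrow> X0) (at_right 0)"
    and lam_lim: "((\<lambda>e. lam e 0) \<longlongrightarrow> l0) (at_right 0)"
    and S: "\<And>s. (S has_real_derivative S' s) (at s)"
    and S': "\<And>s. (S' has_real_derivative (\<rho>\<^sup>2 - 4 * \<rho> / n * X0) * S s) (at s)"
    and S_nonneg: "\<And>s. s \<in> {0..T} \<Longrightarrow> 0 \<le> S s" and ST: "S T = 0"
    and S_start: "0 < S 0 \<or> 0 < S' 0"
  shows "S' 0 + 2 / n * (l0 + n * \<rho> / 2 - X0) * S 0 < 0"
proof -
  have "continuous_on {0..T} S"
    by (intro DERIV_continuous_on[OF has_field_derivative_at_within[OF S]])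
  then have "bounded (S ` {0..T})"
    by (intro compact_imp_bounded compact_continuous_image) auto
  then obtain K where "\<forall>z\<in>S ` {0..T}. norm z \<le> K"
    unfolding bounded_iff by blast
  then have S_bounds: "0 \<le> S s \<and> S s \<le> K" if "s \<in> {0..T}" for s
    using that S_nonneg by (auto simp: abs_le_iff)
  define R where "R = 2 / n * (2 * B + (n * \<bar>\<rho>\<bar> / 2 + A) * T)"
  define m where "m = exp (- R)"
  define M where "M = exp R"
  define \<delta> where "\<delta> e = \<bar>4 * \<rho> / n * (X e - X0)\<bar>" for e
  define d where "d e = S' 0 + 2 / n * (lam e 0 + n * \<rho> / 2 - X e) * S 0 - \<delta> e * M * K * T" for e
  have d_bound: "S 0 + min (d e / M\<^sup>2) (d e / m\<^sup>2) * T \<le> 0" if e: "0 < e" "e \<le> 1" for e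
  proof -
    define \<nu> where "\<nu> = n * \<rho> / 2 - X e"
    define E where "E s = 2 / n * (H e s - H e 0 + \<nu> * s)" for s
    define y where "y s = exp (- E s)" for s
    define y1 where "y1 s = - (2 / n) * (lam e s + \<nu>) * y s" for s
    define y2 where "y2 s = (- (2 / n) * lam' e s + (2 / n * (lam e s + \<nu>))\<^sup>2) * y s" for s
    have sub: "{0..<T} \<subseteq> {0..<t}"
      using T by auto
    have dH: "(H e has_real_derivative lam e s) (at s within {0..<T})"
      and dlam: "(lam e has_real_derivative lam' e s) (at s within {0..<T})" if "s \<in> {0..<T}" for s
      using that sub H[OF e, of s] lam[OF e, of s] by (auto intro: DERIV_subset)
    have dy: "(y has_real_derivative y1 s) (at s within {0..<T})" if s: "s \<in> {0..<T}" for s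
      unfolding y_def y1_def E_def
      by (rule derivative_eq_intros dH[OF s] refl | simp)+
    have "S 0 + min ((S' 0 - y1 0 * S 0 - \<delta> e * M * K * T) / M\<^sup>2)
        ((S' 0 - y1 0 * S 0 - \<delta> e * M * K * T) / m\<^sup>2) * T \<le> 0"
    proof (rule sturm_comparison[OF T(1) dy, where y'' = y2 and S = S and c = "\<rho>\<^sup>2 - 4 * \<rho> / n * X0"])
      fix s assume s: "s \<in> {0..<T}"
      show "(y1 has_real_derivative y2 s) (at s within {0..<T})"
        unfolding y1_def
        by (rule derivative_eq_intros dlam[OF s] dy[OF s] refl | simp)+
          (simp add: y2_def y1_def algebra_simps power2_eq_square)
      have "2 / n * lam' e s \<ge> 2 / n * (2 * \<rho> * lam e s + 2 / n * (X e - lam e s)\<^sup>2)"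
        using riccati[OF e, of s] s sub n by (intro mult_left_mono) auto
      moreover have "(2 / n * (lam e s + \<nu>))\<^sup>2 - 2 / n * (2 * \<rho> * lam e s + 2 / n * (X e - lam e s)\<^sup>2) =
          \<rho>\<^sup>2 - 4 * \<rho> / n * X e"
        using n by (simp add: \<nu>_def field_simps power2_eq_square)
      moreover have "\<rho>\<^sup>2 - 4 * \<rho> / n * X e \<le> \<rho>\<^sup>2 - 4 * \<rho> / n * X0 + \<delta> e"
        using abs_ge_minus_self[of "4 * \<rho> / n * (X e - X0)"]
          right_diff_distrib[of "4 * \<rho> / n" "X e" X0]
        unfolding \<delta>_def by linarith
      ultimately have "- (2 / n) * lam' e s + (2 / n * (lam e s + \<nu>))\<^sup>2 \<le> \<rho>\<^sup>2 - 4 * \<rho> / n * X0 + \<delta> e"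
        by linarith
      then show "y2 s \<le> (\<rho>\<^sup>2 - 4 * \<rho> / n * X0 + \<delta> e) * y s"
        unfolding y2_def by (rule mult_right_mono) (simp add: y_def)
      have "\<bar>\<nu>\<bar> \<le> n * \<bar>\<rho>\<bar> / 2 + A"
        using X_bound[OF e] n abs_triangle_ineq4[of "n * \<rho> / 2" "X e"] by (simp add: \<nu>_def abs_mult)
      then have "\<bar>\<nu> * s\<bar> \<le> (n * \<bar>\<rho>\<bar> / 2 + A) * T"
        unfolding abs_mult using s by (intro mult_mono) auto
      then have "\<bar>H e s - H e 0 + \<nu> * s\<bar> \<le> 2 * B + (n * \<bar>\<rho>\<bar> / 2 + A) * T"
        using H_bound[OF e, of s] H_bound[OF e, of 0] s sub T by (auto simp: abs_le_iff)
      then have "\<bar>E s\<bar> \<le> R"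
        unfolding E_def R_def abs_mult using n by (intro mult_mono) auto
      then show "m \<le> y s \<and> y s \<le> M"
        by (auto simp: m_def M_def y_def abs_le_iff)
    qed (use S S' S_bounds ST in \<open>auto simp: m_def \<delta>_def y_def E_def\<close>)
    moreover have "S' 0 - y1 0 * S 0 - \<delta> e * M * K * T = d e"
      by (simp add: d_def y1_def y_def E_def \<nu>_def algebra_simps)
    ultimately show ?thesis
      by simp
  qed
  define d0 where "d0 = S' 0 + 2 / n * (l0 + n * \<rho> / 2 - X0) * S 0"
  have "(d \<longlongrightarrow> S' 0 + 2 / n * (l0 + n * \<rho> / 2 - X0) * S 0 - \<bar>4 * \<rho> / n * (X0 - X0)\<bar> * M * K * T)
      (at_right 0)"
    unfolding d_def \<delta>_def by (intro tendsto_intros X_lim lam_lim)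
  then have d_lim: "(d \<longlongrightarrow> d0) (at_right 0)"
    by (simp add: d0_def)
  have "((\<lambda>e. S 0 + min (d e / M\<^sup>2) (d e / m\<^sup>2) * T) \<longlongrightarrow>
      S 0 + min (d0 / M\<^sup>2) (d0 / m\<^sup>2) * T) (at_right 0)"
    by (intro tendsto_intros d_lim) (simp_all add: m_def M_def)
  moreover have "\<forall>\<^sub>F e in at_right 0. S 0 + min (d e / M\<^sup>2) (d e / m\<^sup>2) * T \<le> 0"
    using eventually_at_right_real[of 0 1, OF zero_less_one] by eventually_elim (use d_bound in auto)
  ultimately have limit: "S 0 + min (d0 / M\<^sup>2) (d0 / m\<^sup>2) * T \<le> 0"
    by (rule tendsto_upperbound) simp
  show ?thesis
    unfolding d0_def[symmetric]
  proof (rule ccontr)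
    assume "\<not> d0 < 0"
    then have d0: "0 \<le> d0"
      by simp
    then have "0 \<le> min (d0 / M\<^sup>2) (d0 / m\<^sup>2) * T"
      using T by simp
    moreover have "0 \<le> S 0"
      using S_nonneg[of 0] T by simp
    ultimately have "S 0 = 0" "min (d0 / M\<^sup>2) (d0 / m\<^sup>2) * T = 0"
      using limit by linarith+
    then have "d0 = 0"
      using T by (auto simp: min_def m_def M_def split: if_splits)
    then show False
      using S_start \<open>S 0 = 0\<close> by (simp add: d0_def)
  qed
qed

section \<open>Smooth functions of one variable\<close>

lemma smooth_UNIV_D:
  assumes "smooth_fun_on UNIV \<phi>"
  shows "(\<phi> has_real_derivative deriv \<phi> x) (at x)" "smooth_fun_on UNIV (deriv \<phi>)"
proof -
  have k: "(deriv ^^ k) \<phi> differentiable_on UNIV" for k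
    using assms by (auto simp: smooth_fun_on_def)
  show "(\<phi> has_real_derivative deriv \<phi> x) (at x)"
    using k[of 0] by (simp add: differentiable_on_def DERIV_deriv_iff_real_differentiable)
  have "(deriv ^^ k) (deriv \<phi>) differentiable_on UNIV" for k
    using k[of "Suc k"] by (simp only: funpow_Suc_right o_apply)
  then show "smooth_fun_on UNIV (deriv \<phi>)"
    by (simp add: smooth_fun_on_def)
qed

text \<open>
Smooth functions are closed under sums and products because the algebra that they generate is closed
under \<open>deriv\<close> and consists of differentiable functions. Iterating \<open>deriv\<close> inside this algebra replaces
the higher Leibniz rule.
\<close>

inductive_set smooth_algebra :: "(real \<Rightarrow> real) set" where
  "smooth_fun_on UNIV \<phi> \<Longrightarrow> \<phi> \<in> smooth_algebra"
| "\<phi> \<in> smooth_algebra \<Longrightarrow> \<psi> \<in> smooth_algebra \<Longrightarrow> (\<lambda>x. \<phi> x + \<psi> x) \<in> smooth_algebra"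
| "\<phi> \<in> smooth_algebra \<Longrightarrow> \<psi> \<in> smooth_algebra \<Longrightarrow> (\<lambda>x. \<phi> x * \<psi> x) \<in> smooth_algebra"

lemma smooth_algebra_deriv:
  "\<phi> \<in> smooth_algebra \<Longrightarrow>
    deriv \<phi> \<in> smooth_algebra \<and> (\<forall>x. (\<phi> has_real_derivative deriv \<phi> x) (at x))"
proof (induction rule: smooth_algebra.induct)
  case (1 \<phi>)
  then show ?case
    using smooth_UNIV_D smooth_algebra.intros(1) by blast
next
  case (2 \<phi> \<psi>)
  have D: "((\<lambda>x. \<phi> x + \<psi> x) has_real_derivative deriv \<phi> x + deriv \<psi> x) (at x)" for x
    using 2 by (intro derivative_intros) auto
  then have "deriv (\<lambda>x. \<phi> x + \<psi> x) = (\<lambda>x. deriv \<phi> x + deriv \<psi> x)"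
    using DERIV_imp_deriv by blast
  then show ?case
    using 2 D smooth_algebra.intros(2) by simp
next
  case (3 \<phi> \<psi>)
  have D: "((\<lambda>x. \<phi> x * \<psi> x) has_real_derivative deriv \<phi> x * \<psi> x + \<phi> x * deriv \<psi> x) (at x)" for x
    using 3 by (auto intro!: derivative_eq_intros)
  then have "deriv (\<lambda>x. \<phi> x * \<psi> x) = (\<lambda>x. deriv \<phi> x * \<psi> x + \<phi> x * deriv \<psi> x)"
    using DERIV_imp_deriv by blast
  then show ?case
    using 3 D smooth_algebra.intros(2,3) by simp
qed

lemma smooth_algebra_imp_smooth:
  assumes "\<phi> \<in> smooth_algebra"
  shows "smooth_fun_on UNIV \<phi>"
proof -
  have k: "(deriv ^^ k) \<phi> \<in> smooth_algebra" for k
    by (induction k) (use assms smooth_algebra_deriv in auto)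
  have "((deriv ^^ k) \<phi> has_real_derivative deriv ((deriv ^^ k) \<phi>) x) (at x)" for k x
    using smooth_algebra_deriv[OF k[of k]] by fast
  then have "(deriv ^^ k) \<phi> differentiable (at x)" for k x
    unfolding real_differentiable_def by fast
  then show ?thesis
    by (simp add: smooth_fun_on_def differentiable_on_def)
qed

lemma smooth_add:
  "smooth_fun_on UNIV \<phi> \<Longrightarrow> smooth_fun_on UNIV \<psi> \<Longrightarrow> smooth_fun_on UNIV (\<lambda>x. \<phi> x + \<psi> x)"
  by (rule smooth_algebra_imp_smooth[OF smooth_algebra.intros(2)])
    (simp_all add: smooth_algebra.intros(1))

lemma smooth_mult:
  "smooth_fun_on UNIV \<phi> \<Longrightarrow> smooth_fun_on UNIV \<psi> \<Longrightarrow> smooth_fun_on UNIV (\<lambda>x. \<phi> x * \<psi> x)"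
  by (rule smooth_algebra_imp_smooth[OF smooth_algebra.intros(3)])
    (simp_all add: smooth_algebra.intros(1))

lemma smooth_const: "smooth_fun_on UNIV (\<lambda>x. c)"
proof -
  have "\<exists>d. (deriv ^^ k) (\<lambda>x::real. c) = (\<lambda>x. d)" for k
  proof (induction k)
    case (Suc k)
    then obtain d where "(deriv ^^ k) (\<lambda>x::real. c) = (\<lambda>x. d)"
      by blast
    then show ?case
      by (intro exI[of _ 0]) simp
  qed auto
  then have "(deriv ^^ k) (\<lambda>x::real. c) differentiable_on UNIV" for k
    by (metis differentiable_on_const)
  then show ?thesis
    by (simp add: smooth_fun_on_def)
qed

lemma smooth_id: "smooth_fun_on UNIV (\<lambda>x. x)"
proof -
  have d: "deriv (\<lambda>x::real. x) = (\<lambda>x. 1)"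
    by (simp add: fun_eq_iff)
  have "(deriv ^^ k) (\<lambda>x::real. x) differentiable_on UNIV" for k
    using smooth_const[of 1]
    by (cases k) (auto simp: smooth_fun_on_def funpow_Suc_right d simp del: funpow.simps(2)
        intro: differentiable_on_ident)
  then show ?thesis
    by (simp add: smooth_fun_on_def)
qed

lemma smooth_exp: "smooth_fun_on UNIV (exp :: real \<Rightarrow> real)"
proof -
  have d: "deriv exp = (exp :: real \<Rightarrow> real)"
    using DERIV_exp DERIV_imp_deriv by blast
  have "(deriv ^^ k) exp = (exp :: real \<Rightarrow> real)" for k
    by (induction k) (auto simp: d)
  then show ?thesis
    by (simp add: smooth_fun_on_def differentiable_on_def field_differentiable_imp_differentiable
        field_differentiable_within_exp)
qed

lemma smooth_ln: "smooth_fun_on {0<..} (ln :: real \<Rightarrow> real)"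
proof -
  have step: "\<exists>c. \<forall>x>0. (deriv ^^ Suc k) (ln :: real \<Rightarrow> real) x = c / x ^ Suc k" for k
  proof (induction k)
    case 0
    have "deriv ln x = 1 / x" if "x > 0" for x :: real
      using DERIV_ln_divide[OF that] by (rule DERIV_imp_deriv)
    then show ?case
      by (auto intro!: exI[of _ 1])
  next
    case (Suc k)
    then obtain c where c: "\<And>x::real. x > 0 \<Longrightarrow> (deriv ^^ Suc k) ln x = c / x ^ Suc k"
      by blast
    have "(deriv ^^ Suc (Suc k)) ln x = (- (c * Suc k)) / x ^ Suc (Suc k)" if x: "x > 0" for x :: real
    proof -
      have "((\<lambda>x. x ^ Suc k) has_real_derivative Suc k * x ^ k) (at x)"
        using DERIV_pow[of "Suc k" x] by simp
      from DERIV_divide[OF DERIV_const[of c] this]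
      have "((\<lambda>x. c / x ^ Suc k) has_real_derivative (- (c * Suc k)) / x ^ Suc (Suc k)) (at x)"
        using x by (simp add: divide_simps)
      then have "((deriv ^^ Suc k) ln has_real_derivative (- (c * Suc k)) / x ^ Suc (Suc k)) (at x)"
        by (rule has_field_derivative_transform_within_open[where S = "{0<..}"])
          (use x c in auto)
      then show ?thesis
        by (simp add: DERIV_imp_deriv)
    qed
    then show ?case
      by blast
  qed
  have "(deriv ^^ k) ln differentiable (at x)" if x: "x > 0" for x :: real and k
  proof (cases k)
    case 0
    then show ?thesis
      using DERIV_ln_divide[OF x] by (auto simp: real_differentiable_def)
  next
    case (Suc j)
    then obtain c where c: "\<And>x::real. x > 0 \<Longrightarrow> (deriv ^^ k) ln x = c / x ^ k"
      using step by blast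
    have "((\<lambda>x. c / x ^ k) has_real_derivative (- (c * k * x ^ (k - 1))) / (x ^ k * x ^ k)) (at x)"
      using x by (auto intro!: derivative_eq_intros)
    then have "((deriv ^^ k) ln has_real_derivative (- (c * k * x ^ (k - 1))) / (x ^ k * x ^ k)) (at x)"
      by (rule has_field_derivative_transform_within_open[where S = "{0<..}"]) (use x c in auto)
    then show ?thesis
      by (auto simp: real_differentiable_def)
  qed
  then show ?thesis
    by (auto simp: smooth_fun_on_def differentiable_on_def intro: differentiable_at_withinI)
qed

lemma deriv2_mult:
  assumes "smooth_fun_on UNIV \<phi>" "smooth_fun_on UNIV \<psi>"
  shows "deriv (\<lambda>x. \<phi> x * \<psi> x) = (\<lambda>x. deriv \<phi> x * \<psi> x + \<phi> x * deriv \<psi> x)"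
    and "deriv (deriv (\<lambda>x. \<phi> x * \<psi> x)) =
      (\<lambda>x. deriv (deriv \<phi>) x * \<psi> x + 2 * deriv \<phi> x * deriv \<psi> x + \<phi> x * deriv (deriv \<psi>) x)"
proof -
  note D = smooth_UNIV_D[OF assms(1)] smooth_UNIV_D[OF assms(2)]
  note D2 = smooth_UNIV_D(1)[OF D(2)] smooth_UNIV_D(1)[OF D(4)]
  show 1: "deriv (\<lambda>x. \<phi> x * \<psi> x) = (\<lambda>x. deriv \<phi> x * \<psi> x + \<phi> x * deriv \<psi> x)"
    by (rule ext, rule DERIV_imp_deriv) (auto intro!: derivative_eq_intros D)
  show "deriv (deriv (\<lambda>x. \<phi> x * \<psi> x)) =
      (\<lambda>x. deriv (deriv \<phi>) x * \<psi> x + 2 * deriv \<phi> x * deriv \<psi> x + \<phi> x * deriv (deriv \<psi>) x)"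
    unfolding 1
    by (rule ext, rule DERIV_imp_deriv) (auto intro!: derivative_eq_intros D D2)
qed

context markov_diffusion_triple
begin

abbreviation P where "P \<equiv> semigroup_op p"
abbreviation \<B> where "\<B> \<equiv> bounded_algebra \<D>"
abbreviation \<Gamma> where "\<Gamma> \<equiv> carre_du_champ L"

section \<open>The semigroup on bounded functions\<close>

lemma B_iff: "f \<in> \<B> \<longleftrightarrow> f \<in> \<D> \<and> (\<exists>C. \<forall>y. \<bar>f y\<bar> \<le> C)"
  by (auto simp: bounded_algebra_def bounded_iff)

lemma B_I: "f \<in> \<D> \<Longrightarrow> (\<And>y. \<bar>f y\<bar> \<le> C) \<Longrightarrow> f \<in> \<B>"
  using B_iff by blast

lemma B_D: "f \<in> \<B> \<Longrightarrow> f \<in> \<D>"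
  by (simp add: B_iff)

lemma B_bound: "f \<in> \<B> \<Longrightarrow> \<exists>C\<ge>0. \<forall>y. \<bar>f y\<bar> \<le> C"
  using B_iff abs_ge_zero order_trans by metis

lemma B_bdd_below: "f \<in> \<B> \<Longrightarrow> bdd_below (range f)"
  using B_bound[of f] by (force simp: abs_le_iff minus_le_iff intro: bdd_belowI)

lemma B_const: "(\<lambda>y. c) \<in> \<B>"
  by (rule B_I[OF D_const order_refl])

lemma B_add: "f \<in> \<B> \<Longrightarrow> g \<in> \<B> \<Longrightarrow> (\<lambda>y. f y + g y) \<in> \<B>"
  by (auto simp: B_iff intro!: D_add) (metis abs_triangle_ineq add_mono order_trans)

lemma B_mult: "f \<in> \<B> \<Longrightarrow> g \<in> \<B> \<Longrightarrow> (\<lambda>y. f y * g y) \<in> \<B>"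
  by (auto simp: B_iff abs_mult intro!: D_mult) (meson abs_ge_zero mult_mono order_trans)

lemma B_cmult: "f \<in> \<B> \<Longrightarrow> (\<lambda>y. c * f y) \<in> \<B>"
  by (rule B_mult[OF B_const])

lemma B_diff: "f \<in> \<B> \<Longrightarrow> g \<in> \<B> \<Longrightarrow> (\<lambda>y. f y - g y) \<in> \<B>"
  using B_add[OF _ B_cmult[of g "-1"]] by simp

lemmas B_intros = B_const B_add B_mult B_cmult B_diff

lemma B_comp_smooth:
  assumes "f \<in> \<B>" "smooth_fun_on UNIV \<phi>"
  shows "(\<lambda>y. \<phi> (f y)) \<in> \<B>"
proof -
  obtain C where C: "\<And>y. \<bar>f y\<bar> \<le> C"
    using assms(1) B_iff by blast
  have "continuous_on {-C..C} \<phi>"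
    by (intro DERIV_continuous_on[OF has_field_derivative_at_within[OF smooth_UNIV_D(1)[OF assms(2)]]])
  then have "bounded (\<phi> ` {-C..C})"
    by (intro compact_imp_bounded compact_continuous_image) auto
  then obtain K where "\<forall>z\<in>{-C..C}. \<bar>\<phi> z\<bar> \<le> K"
    unfolding bounded_iff by auto
  then have "\<bar>\<phi> (f y)\<bar> \<le> K" for y
    using C[of y] by (auto simp: abs_le_iff)
  then show ?thesis
    using D_smooth[OF B_D[OF assms(1)] assms(2)] by (intro B_I) auto
qed

lemma prob_p: "0 \<le> t \<Longrightarrow> prob_space (p t x)"
  and sets_p: "0 \<le> t \<Longrightarrow> sets (p t x) = sets \<mu>"
  using measurable_space[OF kernel, of t x] by (auto simp: space_prob_algebra space_eq_UNIV)

lemma D_measurable_p: "f \<in> \<D> \<Longrightarrow> 0 \<le> t \<Longrightarrow> f \<in> borel_measurable (p t x)"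
  using D_measurable measurable_cong_sets[OF sets_p refl] by blast

lemma integrable_p: "f \<in> \<B> \<Longrightarrow> 0 \<le> t \<Longrightarrow> integrable (p t x) f"
proof -
  assume f: "f \<in> \<B>" and t: "0 \<le> t"
  interpret prob_space "p t x"
    by (rule prob_p[OF t])
  show ?thesis
    using B_bound[OF f] D_measurable_p[OF B_D[OF f] t]
    by (metis AE_I2 integrable_const_bound real_norm_def)
qed

lemma P_add: "f \<in> \<B> \<Longrightarrow> g \<in> \<B> \<Longrightarrow> 0 \<le> t \<Longrightarrow> P t (\<lambda>y. f y + g y) x = P t f x + P t g x"
  and P_diff: "f \<in> \<B> \<Longrightarrow> g \<in> \<B> \<Longrightarrow> 0 \<le> t \<Longrightarrow> P t (\<lambda>y. f y - g y) x = P t f x - P t g x"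
  and P_cmult: "P t (\<lambda>y. c * f y) x = c * P t f x"
  by (simp_all add: semigroup_op_def integrable_p)

lemma P_const: "0 \<le> t \<Longrightarrow> P t (\<lambda>y. c) x = c"
  using prob_space.prob_space[OF prob_p] by (simp add: semigroup_op_def)

lemma P_mono:
  "integrable (p t x) f \<Longrightarrow> integrable (p t x) g \<Longrightarrow> (\<And>y. f y \<le> g y) \<Longrightarrow> P t f x \<le> P t g x"
  unfolding semigroup_op_def by (rule integral_mono)

lemma P_bounds:
  assumes "f \<in> \<B>" "0 \<le> t"
  shows "(\<And>y. c \<le> f y) \<Longrightarrow> c \<le> P t f x" "(\<And>y. f y \<le> c) \<Longrightarrow> P t f x \<le> c"
    "(\<And>y. \<bar>f y\<bar> \<le> c) \<Longrightarrow> \<bar>P t f x\<bar> \<le> c"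
proof -
  have lo: "c \<le> P t f x" if "\<And>y. c \<le> f y" for c
    using P_mono[of t x "\<lambda>y. c" f] that assms integrable_p B_const P_const by metis
  have hi: "P t f x \<le> c" if "\<And>y. f y \<le> c" for c
    using P_mono[of t x f "\<lambda>y. c"] that assms integrable_p B_const P_const by metis
  show "(\<And>y. c \<le> f y) \<Longrightarrow> c \<le> P t f x" "(\<And>y. f y \<le> c) \<Longrightarrow> P t f x \<le> c"
    using lo hi by auto
  show "(\<And>y. \<bar>f y\<bar> \<le> c) \<Longrightarrow> \<bar>P t f x\<bar> \<le> c"
    using lo[of "- c"] hi[of c] by (simp add: abs_le_iff minus_le_iff)
qed

lemma P_0: "f \<in> \<D> \<Longrightarrow> P 0 f = f"
  unfolding semigroup_op_def kernel_0 using D_measurable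
  by (auto intro!: ext integral_return simp: space_eq_UNIV)

lemma P_semigroup:
  assumes f: "f \<in> \<B>" and "0 \<le> s" "0 \<le> t"
  shows "P s (P t f) = P (s + t) f"
proof
  fix x
  obtain C where C: "\<And>y. \<bar>f y\<bar> \<le> C"
    using f B_iff by blast
  interpret prob_space "p s x"
    by (rule prob_p[OF \<open>0 \<le> s\<close>])
  have "p t \<in> measurable (p s x) (subprob_algebra \<mu>)"
    using measurable_prob_algebraD[OF kernel[OF \<open>0 \<le> t\<close>]]
      measurable_cong_sets[OF sets_p[OF \<open>0 \<le> s\<close>] refl] by blast
  then have "integral\<^sup>L (p s x \<bind> p t) f = (\<integral>z. integral\<^sup>L (p t z) f \<partial>p s x)"
    by (rule integral_bind[where B = C and B' = 1, rotated 2])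
      (use f D_measurable C prob_space.emeasure_space_1[OF prob_p[OF \<open>0 \<le> t\<close>]] in
        \<open>auto simp: B_iff intro: finite_measure_axioms\<close>)
  then show "P s (P t f) x = P (s + t) f x"
    by (simp add: semigroup_op_def chapman_kolmogorov[OF assms(2,3)])
qed

lemma P_B: "f \<in> \<B> \<Longrightarrow> 0 \<le> t \<Longrightarrow> P t f \<in> \<B>"
  by (rule semigroup_closed)

section \<open>Calculus of the carre du champ\<close>

lemma D_cmult: "f \<in> \<D> \<Longrightarrow> (\<lambda>y. c * f y) \<in> \<D>"
  by (rule D_mult[OF D_const])

lemma D_diff: "f \<in> \<D> \<Longrightarrow> g \<in> \<D> \<Longrightarrow> (\<lambda>y. f y - g y) \<in> \<D>"
  using D_add[OF _ D_cmult[of g "-1"]] by simp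

lemmas D_intros = D_const D_add D_mult D_cmult D_diff D_L

lemma L_const: "L (\<lambda>y. c) x = 0"
  using diffusion[OF D_const[of 0] smooth_const[of c]] by simp

lemma L_mult: "L (\<lambda>y. f y * g y) x = f x * L g x + g x * L f x + 2 * \<Gamma> f g x"
  by (simp add: carre_du_champ_def field_simps)

lemma Gamma_D: "f \<in> \<D> \<Longrightarrow> g \<in> \<D> \<Longrightarrow> \<Gamma> f g \<in> \<D>"
proof -
  assume "f \<in> \<D>" "g \<in> \<D>"
  then have "(\<lambda>x. (1/2) * (L (\<lambda>y. f y * g y) x - f x * L g x - g x * L f x)) \<in> \<D>"
    by (intro D_intros)
  then show ?thesis
    by (simp add: carre_du_champ_def[abs_def])
qed

lemma Gamma_sym: "\<Gamma> f g x = \<Gamma> g f x"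
  unfolding carre_du_champ_def by (simp add: mult.commute)

lemma Gamma_add_left:
  "f \<in> \<D> \<Longrightarrow> g \<in> \<D> \<Longrightarrow> h \<in> \<D> \<Longrightarrow> \<Gamma> (\<lambda>y. f y + g y) h x = \<Gamma> f h x + \<Gamma> g h x"
  unfolding carre_du_champ_def by (simp add: L_add D_mult distrib_right) (simp add: field_simps)

lemma Gamma_cmult_left:
  "f \<in> \<D> \<Longrightarrow> h \<in> \<D> \<Longrightarrow> \<Gamma> (\<lambda>y. c * f y) h x = c * \<Gamma> f h x"
  unfolding carre_du_champ_def by (simp add: L_scale D_mult mult.assoc) (simp add: algebra_simps)

lemma Gamma_const_left: "h \<in> \<D> \<Longrightarrow> \<Gamma> (\<lambda>y. c) h x = 0"
  unfolding carre_du_champ_def by (simp add: L_scale L_const)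

lemma Gamma_const_right: "h \<in> \<D> \<Longrightarrow> \<Gamma> h (\<lambda>y. c) x = 0"
  by (subst Gamma_sym) (rule Gamma_const_left)

lemma Gamma_add_right:
  "f \<in> \<D> \<Longrightarrow> g \<in> \<D> \<Longrightarrow> h \<in> \<D> \<Longrightarrow> \<Gamma> h (\<lambda>y. f y + g y) x = \<Gamma> h f x + \<Gamma> h g x"
  by (subst (1 2 3) Gamma_sym) (rule Gamma_add_left)

lemma Gamma_cmult_right:
  "f \<in> \<D> \<Longrightarrow> h \<in> \<D> \<Longrightarrow> \<Gamma> h (\<lambda>y. c * f y) x = c * \<Gamma> h f x"
  by (subst (1 2) Gamma_sym) (rule Gamma_cmult_left)

lemmas Gamma_linear = Gamma_add_left Gamma_add_right Gamma_cmult_left Gamma_cmult_right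

text \<open>
For \<open>q = (f - f x)\<^sup>2\<close>, the function \<open>P\<^sub>s q x\<close> of \<open>s\<close> is nonnegative and vanishes at \<open>0\<close>. Its right
derivative at \<open>0\<close> is \<open>L q x = 2 * \<Gamma> f f x\<close>.
\<close>

lemma Gamma_nonneg:
  assumes f: "f \<in> \<B>"
  shows "0 \<le> \<Gamma> f f x"
proof -
  define q where "q y = (f y - f x) * (f y - f x)" for y
  have d: "(\<lambda>y. f y - f x) \<in> \<B>"
    by (intro B_intros f)
  then have q: "q \<in> \<B>"
    unfolding q_def by (intro B_mult)
  have D: "((\<lambda>s. P s q x) has_real_derivative L q x) (at 0 within {0..})"
    using generator[OF q, of 0] P_0[OF B_D[OF q]] by simp
  have "0 \<le> L q x"
  proof (rule tendsto_lowerbound)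
    show "((\<lambda>s. (P s q x - P 0 q x) / (s - 0)) \<longlongrightarrow> L q x) (at 0 within {0..})"
      using D unfolding has_field_derivative_iff .
    have "P 0 q x = 0"
      using P_0[OF B_D[OF q]] by (simp add: q_def)
    moreover have "0 \<le> P s q x" if "0 \<le> s" for s
      by (rule P_bounds(1)[OF q that]) (simp add: q_def)
    ultimately show "\<forall>\<^sub>F s in at 0 within {0..}. 0 \<le> (P s q x - P 0 q x) / (s - 0)"
      by (auto simp: eventually_at_filter)
    show "at (0::real) within {0..} \<noteq> bot"
      using trivial_limit_at_right_real[of "0::real"] at_within_Ici_at_right[of "0::real"] by metis
  qed
  moreover have "L q x = 2 * \<Gamma> (\<lambda>y. f y - f x) (\<lambda>y. f y - f x) x"
    unfolding q_def by (subst L_mult) simp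
  moreover have "\<Gamma> (\<lambda>y. f y + (- f x)) (\<lambda>y. f y + (- f x)) x = \<Gamma> f f x"
    using B_D[OF f]
    by (simp only: Gamma_add_left Gamma_add_right Gamma_const_left Gamma_const_right D_const D_add)
  ultimately show ?thesis
    by simp
qed

lemma Gamma_bound:
  assumes f: "f \<in> \<B>" and g: "g \<in> \<B>"
  shows "\<bar>\<Gamma> f g x\<bar> \<le> (\<Gamma> f f x + \<Gamma> g g x) / 2"
proof -
  have "0 \<le> \<Gamma> (\<lambda>y. f y + c * g y) (\<lambda>y. f y + c * g y) x" for c
    by (intro Gamma_nonneg B_intros f g)
  then have "0 \<le> \<Gamma> f f x + 2 * c * \<Gamma> f g x + c\<^sup>2 * \<Gamma> g g x" for c
    using f g by (simp add: Gamma_linear D_intros B_D Gamma_sym[of g f] algebra_simps power2_eq_square)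
  from this[of 1] this[of "-1"] show ?thesis
    by (simp add: abs_le_iff)
qed

text \<open>
This is the degenerate case of the Cauchy-Schwarz inequality for the nonnegative form \<open>\<Gamma>\<close> at \<open>x\<close>.
\<close>

lemma Gamma_zero:
  assumes k: "k \<in> \<B>" and h: "h \<in> \<B>" and zero: "\<Gamma> k k x = 0"
  shows "\<Gamma> k h x = 0"
proof (rule ccontr)
  assume nz: "\<Gamma> k h x \<noteq> 0"
  define c where "c = - (\<Gamma> h h x + 1) / (2 * \<Gamma> k h x)"
  have "0 \<le> \<Gamma> (\<lambda>y. h y + c * k y) (\<lambda>y. h y + c * k y) x"
    by (intro Gamma_nonneg B_intros h k)
  also have "\<dots> = \<Gamma> h h x + 2 * c * \<Gamma> k h x"
    using h k by (simp add: Gamma_linear D_intros B_D Gamma_sym[of h k] zero algebra_simps)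
  also have "\<dots> = - 1"
    using nz by (simp add: c_def field_simps)
  finally show False
    by simp
qed

lemma Gamma_comp_self:
  assumes f: "f \<in> \<D>" and \<phi>: "smooth_fun_on UNIV \<phi>"
  shows "\<Gamma> (\<lambda>y. \<phi> (f y)) (\<lambda>y. \<phi> (f y)) x = (deriv \<phi> (f x))\<^sup>2 * \<Gamma> f f x"
  using diffusion[OF f smooth_mult[OF \<phi> \<phi>], of x] diffusion[OF f \<phi>, of x]
  unfolding carre_du_champ_def[of L "\<lambda>y. \<phi> (f y)"] deriv2_mult(2)[OF \<phi> \<phi>]
  unfolding deriv2_mult(1)[OF \<phi> \<phi>]
  by (simp add: algebra_simps power2_eq_square)

text \<open>
The diffusion property concerns functions of a single \<open>f\<close>, but it implies the chain rule against any
other \<open>h\<close>: for the smooth function \<open>\<psi> z = \<phi> z - \<phi>' (f x) * z\<close>, the derivative vanishes at \<open>f x\<close>,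
hence so does \<open>\<Gamma> (\<psi> f) (\<psi> f) x\<close>, hence so does \<open>\<Gamma> (\<psi> f) h x\<close>.
\<close>

lemma Gamma_chain:
  assumes f: "f \<in> \<B>" and h: "h \<in> \<B>" and \<phi>: "smooth_fun_on UNIV \<phi>"
  shows "\<Gamma> (\<lambda>y. \<phi> (f y)) h x = deriv \<phi> (f x) * \<Gamma> f h x"
proof -
  define c where "c = - deriv \<phi> (f x)"
  define \<psi> where "\<psi> z = \<phi> z + c * z" for z
  have \<psi>: "smooth_fun_on UNIV \<psi>"
    unfolding \<psi>_def by (intro smooth_add smooth_mult smooth_const smooth_id \<phi>)
  have "deriv \<psi> (f x) = 0"
    unfolding \<psi>_def
    by (rule DERIV_imp_deriv) (auto intro!: derivative_eq_intros smooth_UNIV_D(1)[OF \<phi>] simp: c_def)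
  then have "\<Gamma> (\<lambda>y. \<psi> (f y)) (\<lambda>y. \<psi> (f y)) x = 0"
    using Gamma_comp_self[OF B_D[OF f] \<psi>] by simp
  then have "\<Gamma> (\<lambda>y. \<psi> (f y)) h x = 0"
    by (rule Gamma_zero[OF B_comp_smooth[OF f \<psi>] h])
  then have "\<Gamma> (\<lambda>y. \<phi> (f y)) h x + c * \<Gamma> f h x = 0"
    unfolding \<psi>_def
    using B_comp_smooth[OF f \<phi>] f h by (simp add: Gamma_linear D_intros B_D)
  then show ?thesis
    by (simp add: c_def)
qed

lemma Gamma_square:
  assumes "f \<in> \<B>" "g \<in> \<B>"
  shows "\<Gamma> f (\<lambda>y. g y * g y) x = 2 * g x * \<Gamma> f g x"
proof -
  have "deriv (\<lambda>z::real. z * z) (g x) = 2 * g x"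
    by (rule DERIV_imp_deriv) (auto intro!: derivative_eq_intros)
  then show ?thesis
    using Gamma_chain[OF assms(2,1) smooth_mult[OF smooth_id smooth_id], of x] by (simp add: Gamma_sym)
qed

text \<open>
By polarization from the chain rule for the square.
\<close>

lemma Gamma_leibniz:
  assumes f: "f \<in> \<B>" and g: "g \<in> \<B>" and h: "h \<in> \<B>"
  shows "\<Gamma> f (\<lambda>y. g y * h y) x = g x * \<Gamma> f h x + h x * \<Gamma> f g x"
proof -
  note D = B_D[OF f] B_D[OF g] B_D[OF h]
  have "\<Gamma> f (\<lambda>y. (g y + h y) * (g y + h y)) x = 2 * (g x + h x) * \<Gamma> f (\<lambda>y. g y + h y) x"
    by (intro Gamma_square B_intros f g h)
  also have "(\<lambda>y. (g y + h y) * (g y + h y)) = (\<lambda>y. g y * g y + (2 * (g y * h y) + h y * h y))"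
    by (simp add: algebra_simps)
  finally show ?thesis
    using Gamma_square[OF f g, of x] Gamma_square[OF f h, of x]
    by (simp add: Gamma_linear D D_intros) (simp add: algebra_simps)
qed

lemma deriv_exp_real: "deriv exp = (exp :: real \<Rightarrow> real)"
  using DERIV_exp DERIV_imp_deriv by blast

lemma L_exp:
  "f \<in> \<D> \<Longrightarrow> L (\<lambda>y. exp (f y)) x = exp (f x) * (L f x + \<Gamma> f f x)"
  using diffusion[OF _ smooth_exp, of f x] by (simp add: deriv_exp_real algebra_simps)

lemma Gamma_exp_left:
  "f \<in> \<B> \<Longrightarrow> h \<in> \<B> \<Longrightarrow> \<Gamma> (\<lambda>y. exp (f y)) h x = exp (f x) * \<Gamma> f h x"
  using Gamma_chain[OF _ _ smooth_exp, of f h x] by (simp add: deriv_exp_real)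

text \<open>
If \<open>u\<close> evolves by \<open>u' = L u\<close>, the term subtracted on the left is the time derivative of
\<open>\<Gamma>(u) / u = u * \<Gamma>(w)\<close>. So this identity gives the production of Fisher information; the terms with
\<open>\<Gamma> w (\<Gamma> w w)\<close> and with \<open>\<Gamma> w w * L u\<close> cancel.
\<close>

lemma fisher_information_bochner:
  assumes w: "w \<in> \<B>" and Lw: "L w \<in> \<B>" and Gw: "\<Gamma> w w \<in> \<B>"
  defines "u \<equiv> \<lambda>y. exp (w y)"
  shows "L (\<lambda>y. u y * \<Gamma> w w y) x - (2 * \<Gamma> u (L u) x / u x - \<Gamma> u u x * L u x / (u x)\<^sup>2) =
    2 * u x * Gamma2 L w x"
proof -
  have u: "u \<in> \<B>"
    unfolding u_def by (rule B_comp_smooth[OF w smooth_exp])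
  have pos: "u x \<noteq> 0"
    by (simp add: u_def)
  have Lu: "L u = (\<lambda>y. u y * (L w y + \<Gamma> w w y))"
    unfolding u_def using L_exp[OF B_D[OF w]] by blast
  have sumB: "(\<lambda>y. L w y + \<Gamma> w w y) \<in> \<B>"
    by (intro B_intros Lw Gw)
  have G: "\<Gamma> u h x = u x * \<Gamma> w h x" if "h \<in> \<B>" for h
    unfolding u_def by (rule Gamma_exp_left[OF w that])
  have uu: "\<Gamma> u u x = (u x)\<^sup>2 * \<Gamma> w w x"
    using G[OF u] G[OF w] by (simp add: Gamma_sym[of w u] power2_eq_square)
  have "L u \<in> \<B>"
    unfolding Lu by (intro B_mult u sumB)
  then have "\<Gamma> u (L u) x = u x * \<Gamma> w (L u) x"
    by (rule G)
  also have "\<Gamma> w (L u) x = u x * (\<Gamma> w (L w) x + \<Gamma> w (\<Gamma> w w) x) + (L w x + \<Gamma> w w x) * (u x * \<Gamma> w w x)"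
    unfolding Lu Gamma_leibniz[OF w u sumB] using G[OF w]
    by (simp add: Gamma_linear B_D w Lw Gw Gamma_sym[of w u])
  finally have uLu: "\<Gamma> u (L u) x =
    u x * (u x * (\<Gamma> w (L w) x + \<Gamma> w (\<Gamma> w w) x) + (L w x + \<Gamma> w w x) * (u x * \<Gamma> w w x))" .
  have "L (\<lambda>y. u y * \<Gamma> w w y) x =
      u x * L (\<Gamma> w w) x + \<Gamma> w w x * L u x + 2 * (u x * \<Gamma> w (\<Gamma> w w) x)"
    by (simp add: L_mult G[OF Gw])
  moreover have "L u x = u x * (L w x + \<Gamma> w w x)"
    by (simp add: Lu)
  ultimately show ?thesis
    unfolding uLu uu Gamma2_def using pos by (simp add: field_simps power2_eq_square)
qed

end

section \<open>Curves of functions that are uniformly differentiable in time\<close>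

definition unif_bounded :: "'r set \<Rightarrow> ('r \<Rightarrow> 'a \<Rightarrow> real) \<Rightarrow> bool" where
  "unif_bounded I g \<longleftrightarrow> (\<exists>C\<ge>0. \<forall>r\<in>I. \<forall>y. \<bar>g r y\<bar> \<le> C)"

lemma unif_bounded_I: "(\<And>r y. r \<in> I \<Longrightarrow> \<bar>g r y\<bar> \<le> C) \<Longrightarrow> unif_bounded I g"
  unfolding unif_bounded_def by (rule exI[of _ "max 0 C"]) (simp add: le_max_iff_disj)

lemma unif_bounded_const: "unif_bounded I (\<lambda>r y. c)"
  by (rule unif_bounded_I[of _ _ "\<bar>c\<bar>"]) simp

lemma unif_bounded_add:
  assumes "unif_bounded I g" "unif_bounded I h"
  shows "unif_bounded I (\<lambda>r y. g r y + h r y)"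
proof -
  obtain C D where "\<And>r y. r \<in> I \<Longrightarrow> \<bar>g r y\<bar> \<le> C" "\<And>r y. r \<in> I \<Longrightarrow> \<bar>h r y\<bar> \<le> D"
    using assms unfolding unif_bounded_def by meson
  then show ?thesis
    by (intro unif_bounded_I[of _ _ "C + D"]) (meson abs_triangle_ineq add_mono order_trans)
qed

lemma unif_bounded_mult:
  assumes "unif_bounded I g" "unif_bounded I h"
  shows "unif_bounded I (\<lambda>r y. g r y * h r y)"
proof -
  obtain C D where "C \<ge> 0" "\<And>r y. r \<in> I \<Longrightarrow> \<bar>g r y\<bar> \<le> C" "\<And>r y. r \<in> I \<Longrightarrow> \<bar>h r y\<bar> \<le> D"
    using assms unfolding unif_bounded_def by meson
  then show ?thesis
    by (intro unif_bounded_I[of _ _ "C * D"]) (simp add: abs_mult mult_mono)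
qed

lemma unif_bounded_cong:
  "(\<And>r y. r \<in> I \<Longrightarrow> g r y = h r y) \<Longrightarrow> unif_bounded I g \<longleftrightarrow> unif_bounded I h"
  by (simp add: unif_bounded_def)

text \<open>
Differentiability in time with a quadratic remainder that is uniform in space. The uniformity is what
allows the kernels, which integrate over space, to be applied to the expansion.
\<close>

definition uniform_curve :: "real set \<Rightarrow> (real \<Rightarrow> 'a \<Rightarrow> real) \<Rightarrow> (real \<Rightarrow> 'a \<Rightarrow> real) \<Rightarrow> bool" where
  "uniform_curve I g g' \<longleftrightarrow> unif_bounded I g \<and> unif_bounded I g' \<and>
    (\<exists>C. \<forall>r\<in>I. \<forall>s\<in>I. \<forall>y. \<bar>g s y - g r y - (s - r) * g' r y\<bar> \<le> C * (s - r)\<^sup>2)"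

lemma uniform_curve_D:
  assumes "uniform_curve I g g'"
  obtains C where "C \<ge> 0" "\<And>r y. r \<in> I \<Longrightarrow> \<bar>g r y\<bar> \<le> C" "\<And>r y. r \<in> I \<Longrightarrow> \<bar>g' r y\<bar> \<le> C"
    "\<And>r s y. r \<in> I \<Longrightarrow> s \<in> I \<Longrightarrow> \<bar>g s y - g r y\<bar> \<le> 2 * C * \<bar>s - r\<bar>"
    "\<And>r s y. r \<in> I \<Longrightarrow> s \<in> I \<Longrightarrow> \<bar>g s y - g r y - (s - r) * g' r y\<bar> \<le> C * (s - r)\<^sup>2"
proof -
  obtain A B K where A: "A \<ge> 0" "\<And>r y. r \<in> I \<Longrightarrow> \<bar>g r y\<bar> \<le> A"
    and B: "\<And>r y. r \<in> I \<Longrightarrow> \<bar>g' r y\<bar> \<le> B"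
    and K: "\<And>r s y. r \<in> I \<Longrightarrow> s \<in> I \<Longrightarrow> \<bar>g s y - g r y - (s - r) * g' r y\<bar> \<le> K * (s - r)\<^sup>2"
    using assms unfolding uniform_curve_def unif_bounded_def by meson
  define C where "C = max A (max B K)"
  have C: "C \<ge> 0" "A \<le> C" "B \<le> C" "K \<le> C"
    using A(1) by (auto simp: C_def)
  have g: "\<bar>g r y\<bar> \<le> C" and g': "\<bar>g' r y\<bar> \<le> C" if "r \<in> I" for r y
    using A(2)[OF that] B[OF that] C order_trans by blast+
  have rem: "\<bar>g s y - g r y - (s - r) * g' r y\<bar> \<le> C * (s - r)\<^sup>2" if "r \<in> I" "s \<in> I" for r s y
    using K[OF that, of y] mult_right_mono[OF C(4), of "(s - r)\<^sup>2"] by simp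
  have "\<bar>g s y - g r y\<bar> \<le> 2 * C * \<bar>s - r\<bar>" if rs: "r \<in> I" "s \<in> I" for r s y
  proof (cases "\<bar>s - r\<bar> \<le> 1")
    case True
    have "\<bar>(s - r) * g' r y\<bar> \<le> \<bar>s - r\<bar> * C"
      using g'[OF rs(1)] by (simp add: abs_mult mult_left_mono)
    moreover have "C * (s - r)\<^sup>2 \<le> C * \<bar>s - r\<bar>"
      using True C(1) mult_left_mono[of "\<bar>s - r\<bar>" 1 "\<bar>s - r\<bar>"]
      by (intro mult_left_mono) (auto simp: power2_eq_square)
    ultimately show ?thesis
      using rem[OF rs, of y] by (simp add: algebra_simps)
  next
    case False
    have "\<bar>g s y - g r y\<bar> \<le> 2 * C"
      using g[OF rs(1), of y] g[OF rs(2), of y] by linarith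
    also have "\<dots> \<le> 2 * C * \<bar>s - r\<bar>"
      using False C(1) mult_left_mono[of 1 "\<bar>s - r\<bar>" "2 * C"] by simp
    finally show ?thesis .
  qed
  with C(1) g g' rem show ?thesis
    using that by blast
qed

lemma uniform_curve_I:
  assumes "unif_bounded I g" "unif_bounded I g'"
    and "\<And>r s y. r \<in> I \<Longrightarrow> s \<in> I \<Longrightarrow> \<bar>g s y - g r y - (s - r) * g' r y\<bar> \<le> C * (s - r)\<^sup>2"
  shows "uniform_curve I g g'"
  using assms by (auto simp: uniform_curve_def)

lemma uniform_curve_cong:
  assumes "uniform_curve I g g'"
    and "\<And>r y. r \<in> I \<Longrightarrow> h r y = g r y" "\<And>r y. r \<in> I \<Longrightarrow> h' r y = g' r y"
  shows "uniform_curve I h h'"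
  using assms by (simp add: uniform_curve_def unif_bounded_def)

lemma uniform_curve_add:
  assumes "uniform_curve I g g'" "uniform_curve I h h'"
  shows "uniform_curve I (\<lambda>r y. g r y + h r y) (\<lambda>r y. g' r y + h' r y)"
proof -
  obtain A B
    where A: "\<And>r s y. r \<in> I \<Longrightarrow> s \<in> I \<Longrightarrow> \<bar>g s y - g r y - (s - r) * g' r y\<bar> \<le> A * (s - r)\<^sup>2"
      and B: "\<And>r s y. r \<in> I \<Longrightarrow> s \<in> I \<Longrightarrow> \<bar>h s y - h r y - (s - r) * h' r y\<bar> \<le> B * (s - r)\<^sup>2"
    using assms unfolding uniform_curve_def by meson
  show ?thesis
  proof (rule uniform_curve_I)
    fix r s y assume "r \<in> I" "s \<in> I"
    from A[OF this, of y] B[OF this, of y]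
    show "\<bar>(g s y + h s y) - (g r y + h r y) - (s - r) * (g' r y + h' r y)\<bar> \<le> (A + B) * (s - r)\<^sup>2"
      by (simp add: algebra_simps abs_le_iff)
  qed (use assms in \<open>auto simp: uniform_curve_def intro: unif_bounded_add\<close>)
qed

lemma uniform_curve_mult:
  assumes "uniform_curve I g g'" "uniform_curve I h h'"
  shows "uniform_curve I (\<lambda>r y. g r y * h r y) (\<lambda>r y. g' r y * h r y + g r y * h' r y)"
proof -
  obtain A where A: "A \<ge> 0" "\<And>r y. r \<in> I \<Longrightarrow> \<bar>g r y\<bar> \<le> A"
    "\<And>r s y. r \<in> I \<Longrightarrow> s \<in> I \<Longrightarrow> \<bar>g s y - g r y\<bar> \<le> 2 * A * \<bar>s - r\<bar>"
    "\<And>r s y. r \<in> I \<Longrightarrow> s \<in> I \<Longrightarrow> \<bar>g s y - g r y - (s - r) * g' r y\<bar> \<le> A * (s - r)\<^sup>2"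
    using uniform_curve_D[OF assms(1)] by metis
  obtain B where B: "B \<ge> 0" "\<And>r y. r \<in> I \<Longrightarrow> \<bar>h r y\<bar> \<le> B"
    "\<And>r s y. r \<in> I \<Longrightarrow> s \<in> I \<Longrightarrow> \<bar>h s y - h r y\<bar> \<le> 2 * B * \<bar>s - r\<bar>"
    "\<And>r s y. r \<in> I \<Longrightarrow> s \<in> I \<Longrightarrow> \<bar>h s y - h r y - (s - r) * h' r y\<bar> \<le> B * (s - r)\<^sup>2"
    using uniform_curve_D[OF assms(2)] by metis
  show ?thesis
  proof (rule uniform_curve_I)
    fix r s y assume rs: "r \<in> I" "s \<in> I"
    define X where "X = g s y - g r y - (s - r) * g' r y"
    define Y where "Y = h s y - h r y - (s - r) * h' r y"
    have sq: "(s - r)\<^sup>2 = \<bar>s - r\<bar> * \<bar>s - r\<bar>"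
      by (simp add: power2_eq_square)
    define Z where "Z = A * B * (s - r)\<^sup>2"
    have "\<bar>X * h r y\<bar> \<le> (A * (s - r)\<^sup>2) * B"
      unfolding abs_mult X_def by (intro mult_mono A(4) B(2) rs) (use A(1) in auto)
    then have 1: "\<bar>X * h r y\<bar> \<le> Z"
      by (simp add: Z_def mult.commute mult.left_commute)
    have "\<bar>g r y * Y\<bar> \<le> A * (B * (s - r)\<^sup>2)"
      unfolding abs_mult Y_def by (intro mult_mono A(2) B(4) rs) (use A(1) in auto)
    then have 2: "\<bar>g r y * Y\<bar> \<le> Z"
      by (simp add: Z_def mult.assoc)
    have "\<bar>(g s y - g r y) * (h s y - h r y)\<bar> \<le> (2 * A * \<bar>s - r\<bar>) * (2 * B * \<bar>s - r\<bar>)"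
      unfolding abs_mult by (intro mult_mono A(3) B(3) rs) (use A(1) in auto)
    also have "\<dots> = 4 * Z"
      unfolding Z_def sq by (simp del: abs_mult_self_eq)
    finally have 3: "\<bar>(g s y - g r y) * (h s y - h r y)\<bar> \<le> 4 * Z" .
    have "\<bar>X * h r y + g r y * Y + (g s y - g r y) * (h s y - h r y)\<bar> \<le>
        \<bar>X * h r y\<bar> + \<bar>g r y * Y\<bar> + \<bar>(g s y - g r y) * (h s y - h r y)\<bar>"
      by (intro order_trans[OF abs_triangle_ineq] add_right_mono abs_triangle_ineq)
    also have "\<dots> \<le> Z + Z + 4 * Z"
      by (intro add_mono 1 2 3)
    finally have "\<bar>X * h r y + g r y * Y + (g s y - g r y) * (h s y - h r y)\<bar> \<le> 6 * Z"
      by simp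
    then have "\<bar>X * h r y + g r y * Y + (g s y - g r y) * (h s y - h r y)\<bar> \<le> 6 * A * B * (s - r)\<^sup>2"
      by (simp add: Z_def mult.assoc)
    moreover have "X * h r y + g r y * Y + (g s y - g r y) * (h s y - h r y) =
        g s y * h s y - g r y * h r y - (s - r) * (g' r y * h r y + g r y * h' r y)"
      by (simp add: X_def Y_def algebra_simps)
    ultimately show "\<bar>g s y * h s y - g r y * h r y - (s - r) * (g' r y * h r y + g r y * h' r y)\<bar>
        \<le> 6 * A * B * (s - r)\<^sup>2"
      by simp
  qed (use assms in \<open>auto simp: uniform_curve_def intro!: unif_bounded_add unif_bounded_mult\<close>)
qed

lemma uniform_curve_const: "uniform_curve I (\<lambda>r y. c) (\<lambda>r y. 0)"
  by (rule uniform_curve_I[of _ _ _ 0]) (simp_all add: unif_bounded_const)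

lemma uniform_curve_cmult:
  "uniform_curve I g g' \<Longrightarrow> uniform_curve I (\<lambda>r y. c * g r y) (\<lambda>r y. c * g' r y)"
  using uniform_curve_mult[OF uniform_curve_const[of I c]] by simp

lemma uniform_curve_comp:
  assumes "uniform_curve I g g'"
    and J: "\<And>r y. r \<in> I \<Longrightarrow> g r y \<in> J"
    and rem: "\<And>a b. a \<in> J \<Longrightarrow> b \<in> J \<Longrightarrow> \<bar>\<phi> b - \<phi> a - (b - a) * \<phi>' a\<bar> \<le> K * (b - a)\<^sup>2"
    and \<phi>: "\<And>a. a \<in> J \<Longrightarrow> \<bar>\<phi> a\<bar> \<le> K" and \<phi>': "\<And>a. a \<in> J \<Longrightarrow> \<bar>\<phi>' a\<bar> \<le> K"
  shows "uniform_curve I (\<lambda>r y. \<phi> (g r y)) (\<lambda>r y. \<phi>' (g r y) * g' r y)"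
proof -
  obtain A where A: "A \<ge> 0" "\<And>r y. r \<in> I \<Longrightarrow> \<bar>g' r y\<bar> \<le> A"
    "\<And>r s y. r \<in> I \<Longrightarrow> s \<in> I \<Longrightarrow> \<bar>g s y - g r y\<bar> \<le> 2 * A * \<bar>s - r\<bar>"
    "\<And>r s y. r \<in> I \<Longrightarrow> s \<in> I \<Longrightarrow> \<bar>g s y - g r y - (s - r) * g' r y\<bar> \<le> A * (s - r)\<^sup>2"
    using uniform_curve_D[OF assms(1)] by metis
  show ?thesis
  proof (rule uniform_curve_I)
    show "unif_bounded I (\<lambda>r y. \<phi> (g r y))"
      by (rule unif_bounded_I[of _ _ K]) (use J \<phi> in auto)
    show "unif_bounded I (\<lambda>r y. \<phi>' (g r y) * g' r y)"
      using assms(1) J \<phi>' by (intro unif_bounded_mult) (auto simp: uniform_curve_def intro: unif_bounded_I)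
    fix r s y assume rs: "r \<in> I" "s \<in> I"
    define a where "a = g r y"
    define b where "b = g s y"
    have ab: "a \<in> J" "b \<in> J"
      using J rs by (auto simp: a_def b_def)
    have K: "0 \<le> K"
      using \<phi>[OF ab(1)] by linarith
    have "(b - a)\<^sup>2 \<le> (2 * A * \<bar>s - r\<bar>)\<^sup>2"
      using A(3)[OF rs, of y] by (intro abs_le_square_iff[THEN iffD1]) (simp add: a_def b_def)
    then have "K * (b - a)\<^sup>2 \<le> K * (4 * A\<^sup>2 * (s - r)\<^sup>2)"
      using K by (intro mult_left_mono) (simp_all add: power_mult_distrib)
    with rem[OF ab] have 1: "\<bar>\<phi> b - \<phi> a - (b - a) * \<phi>' a\<bar> \<le> K * (4 * A\<^sup>2 * (s - r)\<^sup>2)"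
      by linarith
    have 2: "\<bar>\<phi>' a * (b - a - (s - r) * g' r y)\<bar> \<le> K * (A * (s - r)\<^sup>2)"
      unfolding abs_mult a_def b_def
      by (intro mult_mono A(4) rs \<phi>' J) (use K in auto)
    have "\<phi> b - \<phi> a - (s - r) * (\<phi>' a * g' r y) =
        (\<phi> b - \<phi> a - (b - a) * \<phi>' a) + \<phi>' a * (b - a - (s - r) * g' r y)"
      by (simp add: algebra_simps)
    with 1 2 have "\<bar>\<phi> b - \<phi> a - (s - r) * (\<phi>' a * g' r y)\<bar> \<le> (4 * K * A\<^sup>2 + K * A) * (s - r)\<^sup>2"
      by (simp add: algebra_simps)
    then show "\<bar>\<phi> (g s y) - \<phi> (g r y) - (s - r) * (\<phi>' (g r y) * g' r y)\<bar>
        \<le> (4 * K * A\<^sup>2 + K * A) * (s - r)\<^sup>2"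
      by (simp add: a_def b_def)
  qed
qed

lemma uniform_curve_inverse:
  assumes "uniform_curve I g g'" and "0 < \<epsilon>" and g: "\<And>r y. r \<in> I \<Longrightarrow> \<epsilon> \<le> g r y"
  shows "uniform_curve I (\<lambda>r y. 1 / g r y) (\<lambda>r y. - 1 / (g r y)\<^sup>2 * g' r y)"
proof (rule uniform_curve_comp[OF assms(1), where J = "{\<epsilon>..}"
      and K = "max (1 / \<epsilon>) (max (1 / \<epsilon>\<^sup>2) (1 / \<epsilon> ^ 3))" and \<phi> = "\<lambda>z. 1 / z" and \<phi>' = "\<lambda>z. - 1 / z\<^sup>2"])
  fix a b assume ab: "a \<in> {\<epsilon>..}" "b \<in> {\<epsilon>..}"
  have pos: "0 < a" "0 < b"
    using ab assms(2) by auto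
  have "1 / b - 1 / a - (b - a) * (- 1 / a\<^sup>2) = (b - a)\<^sup>2 / (a\<^sup>2 * b)"
    using pos by (simp add: field_simps power2_eq_square)
  also have "\<bar>\<dots>\<bar> \<le> (b - a)\<^sup>2 / \<epsilon> ^ 3"
  proof -
    have "\<epsilon> ^ 3 \<le> a\<^sup>2 * b"
      using ab assms(2) pos
      by (simp only: power3_eq_cube power2_eq_square) (intro mult_mono, auto)
    then show ?thesis
      using pos assms(2) by (simp add: divide_left_mono)
  qed
  also have "\<dots> \<le> max (1 / \<epsilon>) (max (1 / \<epsilon>\<^sup>2) (1 / \<epsilon> ^ 3)) * (b - a)\<^sup>2"
    using mult_right_mono[of "1 / \<epsilon> ^ 3" "max (1 / \<epsilon>) (max (1 / \<epsilon>\<^sup>2) (1 / \<epsilon> ^ 3))" "(b - a)\<^sup>2"] by simp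
  finally show "\<bar>1 / b - 1 / a - (b - a) * (- 1 / a\<^sup>2)\<bar> \<le>
      max (1 / \<epsilon>) (max (1 / \<epsilon>\<^sup>2) (1 / \<epsilon> ^ 3)) * (b - a)\<^sup>2" .
next
  fix a assume a: "a \<in> {\<epsilon>..}"
  have "1 / a \<le> 1 / \<epsilon>" "1 / a\<^sup>2 \<le> 1 / \<epsilon>\<^sup>2"
    using a assms(2) by (auto intro!: divide_left_mono power_mono mult_pos_pos)
  then show "\<bar>1 / a\<bar> \<le> max (1 / \<epsilon>) (max (1 / \<epsilon>\<^sup>2) (1 / \<epsilon> ^ 3))"
    "\<bar>- 1 / a\<^sup>2\<bar> \<le> max (1 / \<epsilon>) (max (1 / \<epsilon>\<^sup>2) (1 / \<epsilon> ^ 3))"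
    using a assms(2) by (auto simp: le_max_iff_disj)
qed (use g in auto)

lemma uniform_curve_ln:
  assumes "uniform_curve I g g'" and "0 < \<epsilon>" and g: "\<And>r y. r \<in> I \<Longrightarrow> \<epsilon> \<le> g r y"
  shows "uniform_curve I (\<lambda>r y. ln (g r y)) (\<lambda>r y. 1 / g r y * g' r y)"
proof -
  obtain A where A: "\<And>r y. r \<in> I \<Longrightarrow> \<bar>g r y\<bar> \<le> A"
    using uniform_curve_D[OF assms(1)] by metis
  define K where "K = max (max \<bar>ln \<epsilon>\<bar> \<bar>ln A\<bar>) (max (1 / \<epsilon>) (1 / \<epsilon>\<^sup>2))"
  show ?thesis
  proof (rule uniform_curve_comp[OF assms(1), where J = "{\<epsilon>..A}" and K = K])
    fix a b assume ab: "a \<in> {\<epsilon>..A}" "b \<in> {\<epsilon>..A}"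
    have pos: "0 < a" "0 < b"
      using ab assms(2) by auto
    have "ln b - ln a \<le> b / a - 1"
      using pos ln_le_minus_one[of "b / a"] by (simp add: ln_div)
    moreover have "b / a - 1 = (b - a) * (1 / a)"
      using pos by (simp add: field_simps)
    ultimately have up: "ln b - ln a - (b - a) * (1 / a) \<le> 0"
      by simp
    have "ln a - ln b \<le> a / b - 1"
      using pos ln_le_minus_one[of "a / b"] by (simp add: ln_div)
    moreover have "a / b - 1 + (b - a) * (1 / a) = (b - a)\<^sup>2 / (a * b)"
      using pos by (simp add: field_simps power2_eq_square)
    moreover have "(b - a)\<^sup>2 / (a * b) \<le> (b - a)\<^sup>2 / \<epsilon>\<^sup>2"
    proof -
      have "\<epsilon>\<^sup>2 \<le> a * b"
        using ab assms(2) unfolding power2_eq_square by (intro mult_mono) auto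
      then show ?thesis
        using pos assms(2) by (simp add: divide_left_mono)
    qed
    moreover have "(b - a)\<^sup>2 / \<epsilon>\<^sup>2 \<le> K * (b - a)\<^sup>2"
      using mult_right_mono[of "1 / \<epsilon>\<^sup>2" K "(b - a)\<^sup>2"] by (simp add: K_def)
    ultimately show "\<bar>ln b - ln a - (b - a) * (1 / a)\<bar> \<le> K * (b - a)\<^sup>2"
      using up by linarith
  next
    fix a assume a: "a \<in> {\<epsilon>..A}"
    have "ln \<epsilon> \<le> ln a" "ln a \<le> ln A"
      using a assms(2) by auto
    then show "\<bar>ln a\<bar> \<le> K"
      by (auto simp: K_def)
    have "1 / a \<le> 1 / \<epsilon>"
      using a assms(2) by (auto intro!: divide_left_mono)
    then show "\<bar>1 / a\<bar> \<le> K"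
      using a assms(2) by (auto simp: K_def le_max_iff_disj)
  qed (use g A in \<open>auto intro: order_trans[OF abs_ge_self]\<close>)
qed

context markov_diffusion_triple
begin

lemma P_derivative:
  assumes "f \<in> \<B>" "0 \<le> a" "r \<in> {a..b}"
  shows "((\<lambda>r. P r f y) has_real_derivative L (P r f) y) (at r within {a..b})"
  by (rule DERIV_subset[OF generator]) (use assms in auto)

lemma L_P: "f \<in> \<B> \<Longrightarrow> L f \<in> \<B> \<Longrightarrow> 0 \<le> t \<Longrightarrow> L (P t f) = P t (L f)"
  using commute[OF _ B_bdd_below, of f t] by (simp add: fun_eq_iff)

lemma P_increment:
  assumes f: "f \<in> \<B>" and Lf: "\<And>y. \<bar>L f y\<bar> \<le> C" and "0 \<le> \<tau>"
  shows "\<bar>P \<tau> f y - f y\<bar> \<le> C * \<tau>"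
proof -
  have LB: "L f \<in> \<B>"
    using Lf D_L[OF B_D[OF f]] by (rule B_I[rotated])
  have "norm (P \<tau> f y - P 0 f y) \<le> C * norm (\<tau> - 0)"
  proof (rule field_differentiable_bound[of "{0..\<tau>}"])
    fix z assume "z \<in> {0..\<tau>}"
    then show "((\<lambda>r. P r f y) has_real_derivative L (P z f) y) (at z within {0..\<tau>})"
      by (intro P_derivative f) auto
    show "norm (L (P z f) y) \<le> C"
      using \<open>z \<in> {0..\<tau>}\<close> P_bounds(3)[OF LB, of z C] Lf by (simp add: L_P[OF f LB])
  qed (use \<open>0 \<le> \<tau>\<close> in auto)
  then show ?thesis
    using \<open>0 \<le> \<tau>\<close> P_0[OF B_D[OF f]] by simp
qed

lemma L_as_limit:
  assumes "f \<in> \<B>"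
  shows "((\<lambda>\<tau>. (P \<tau> f y - f y) / \<tau>) \<longlongrightarrow> L f y) (at_right 0)"
  using generator[OF assms, of 0 y] P_0[OF B_D[OF assms]]
  unfolding has_field_derivative_iff at_within_Ici_at_right by simp

lemma P_remainder:
  assumes g: "g \<in> \<B>" and h: "h \<in> \<B>" and k: "k \<in> \<B>" and "0 \<le> \<tau>"
    and rem: "\<And>y. \<bar>g y - h y - c * k y\<bar> \<le> K"
  shows "\<bar>P \<tau> g y - P \<tau> h y - c * P \<tau> k y\<bar> \<le> K"
proof -
  have "P \<tau> (\<lambda>y. g y - h y - c * k y) y = P \<tau> g y - P \<tau> h y - c * P \<tau> k y"
    using g h k \<open>0 \<le> \<tau>\<close> by (simp add: P_diff P_cmult B_intros)
  moreover have "\<bar>P \<tau> (\<lambda>y. g y - h y - c * k y) y\<bar> \<le> K"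
    by (rule P_bounds(3)[OF _ \<open>0 \<le> \<tau>\<close> rem]) (intro B_intros g h k)
  ultimately show ?thesis
    by simp
qed

text \<open>
Taylor expansion in \<open>r\<close> of the difference quotient \<open>(P\<^sub>\<tau> (g r) - g r) / \<tau>\<close>: its second derivative is
\<open>(P\<^sub>\<tau> (g'' r) - g'' r) / \<tau>\<close>, which is bounded by \<open>sup \<bar>L (g'' r)\<bar>\<close> for every \<open>\<tau>\<close>. The remainder
estimate therefore survives \<open>\<tau> \<rightarrow> 0\<close>, without any continuity of \<open>L\<close>.
\<close>

lemma uniform_curve_L:
  assumes g: "uniform_curve {a..b} g g'" and g': "uniform_curve {a..b} g' g''"
    and B: "\<And>r. r \<in> {a..b} \<Longrightarrow> g r \<in> \<B> \<and> g' r \<in> \<B> \<and> g'' r \<in> \<B>"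
    and Lg: "unif_bounded {a..b} (\<lambda>r. L (g r))" and Lg': "unif_bounded {a..b} (\<lambda>r. L (g' r))"
    and Lg'': "unif_bounded {a..b} (\<lambda>r. L (g'' r))"
  shows "uniform_curve {a..b} (\<lambda>r. L (g r)) (\<lambda>r. L (g' r))"
proof -
  obtain C where C: "\<And>r y. r \<in> {a..b} \<Longrightarrow> \<bar>L (g'' r) y\<bar> \<le> C"
    using Lg'' unfolding unif_bounded_def by blast
  have D: "((\<lambda>r. P \<tau> (h r) y - h r y) has_real_derivative P \<tau> (h' r) y - h' r y) (at r within {a..b})"
    if h: "uniform_curve {a..b} h h'" and hB: "\<And>r. r \<in> {a..b} \<Longrightarrow> h r \<in> \<B> \<and> h' r \<in> \<B>"
      and \<tau>: "0 \<le> \<tau>" and r: "r \<in> {a..b}" for h h' \<tau> r y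
  proof -
    obtain K where K: "\<And>r s y. r \<in> {a..b} \<Longrightarrow> s \<in> {a..b} \<Longrightarrow>
        \<bar>h s y - h r y - (s - r) * h' r y\<bar> \<le> K * (s - r)\<^sup>2"
      using h unfolding uniform_curve_def by blast
    have "((\<lambda>r. P \<tau> (h r) y) has_real_derivative P \<tau> (h' r) y) (at r within {a..b})"
      by (rule quadratic_remainder_imp_derivative[of _ _ _ _ K])
        (intro P_remainder K r \<tau>; use hB r in blast)
    moreover have "((\<lambda>r. h r y) has_real_derivative h' r y) (at r within {a..b})"
      by (rule quadratic_remainder_imp_derivative[of _ _ _ _ K]) (intro K r)
    ultimately show ?thesis
      by (rule DERIV_diff)
  qed
  show ?thesis
  proof (rule uniform_curve_I[OF Lg Lg'])
    fix r s y assume rs: "r \<in> {a..b}" "s \<in> {a..b}"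
    define q where "q \<tau> h = (P \<tau> h y - h y) / \<tau>" for \<tau> h
    have "\<bar>q \<tau> (g s) - q \<tau> (g r) - (s - r) * q \<tau> (g' r)\<bar> \<le> C * (s - r)\<^sup>2" if \<tau>: "0 < \<tau>" for \<tau>
    proof -
      have "\<bar>(P \<tau> (g s) y - g s y) - (P \<tau> (g r) y - g r y) - (s - r) * (P \<tau> (g' r) y - g' r y)\<bar>
          \<le> (C * \<tau>) * (s - r)\<^sup>2"
      proof (rule quadratic_taylor_remainder[OF D[OF g] D[OF g'] _ rs])
        fix r assume "r \<in> {a..b}"
        then show "\<bar>P \<tau> (g'' r) y - g'' r y\<bar> \<le> C * \<tau>"
          by (intro P_increment C) (use B \<tau> in auto)
      qed (use B \<tau> in auto)
      moreover have "q \<tau> (g s) - q \<tau> (g r) - (s - r) * q \<tau> (g' r) =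
          ((P \<tau> (g s) y - g s y) - (P \<tau> (g r) y - g r y) - (s - r) * (P \<tau> (g' r) y - g' r y)) / \<tau>"
        by (simp add: q_def diff_divide_distrib right_diff_distrib)
      ultimately show ?thesis
        using \<tau> by (simp add: abs_divide divide_le_eq mult.commute mult.left_commute)
    qed
    moreover have "((\<lambda>\<tau>. \<bar>q \<tau> (g s) - q \<tau> (g r) - (s - r) * q \<tau> (g' r)\<bar>) \<longlongrightarrow>
        \<bar>L (g s) y - L (g r) y - (s - r) * L (g' r) y\<bar>) (at_right 0)"
      unfolding q_def using B rs by (intro tendsto_intros L_as_limit) auto
    ultimately show "\<bar>L (g s) y - L (g r) y - (s - r) * L (g' r) y\<bar> \<le> C * (s - r)\<^sup>2"
      by (intro tendsto_upperbound[where F = "at_right (0::real)"])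
        (auto simp: eventually_at_right_less eventually_at_filter)
  qed
qed

text \<open>
The lower bound on \<open>L (g (t - s))\<close> is the hypothesis under which \<open>L\<close> commutes with \<open>P\<^sub>s\<close>; in the
application to the Fisher information it comes from the curvature-dimension condition.
\<close>

lemma moving_integrand_derivative:
  assumes g: "uniform_curve {a..t} g g'"
    and B: "\<And>r. r \<in> {a..t} \<Longrightarrow> g r \<in> \<B> \<and> g' r \<in> \<B>"
    and s: "s \<in> {0..t - a}"
    and below: "bdd_below (range (L (g (t - s))))"
  shows "((\<lambda>\<sigma>. P \<sigma> (g (t - \<sigma>)) x) has_real_derivative
    P s (\<lambda>y. L (g (t - s)) y - g' (t - s) y) x) (at s within {0..t - a})"
proof -
  define G where "G = g (t - s)"
  define G' where "G' = g' (t - s)"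
  have GB: "G \<in> \<B>" "G' \<in> \<B>"
    using B[of "t - s"] s by (auto simp: G_def G'_def)
  obtain K where K: "\<And>r s y. r \<in> {a..t} \<Longrightarrow> s \<in> {a..t} \<Longrightarrow>
      \<bar>g s y - g r y - (s - r) * g' r y\<bar> \<le> K * (s - r)\<^sup>2"
    using g unfolding uniform_curve_def by blast
  (* To first order in \<sigma> - s, the integrand is g (t - s) - (\<sigma> - s) * g' (t - s). On this fixed pair of
     functions the generator axiom applies; the rest is quadratically small, uniformly in space. *)
  define main where "main \<sigma> = P \<sigma> G x - (\<sigma> - s) * P \<sigma> G' x" for \<sigma>
  have "(main has_real_derivative L (P s G) x - P s G' x) (at s within {0..t - a})"
    unfolding main_def
    by (rule derivative_eq_intros P_derivative GB order_refl s refl | simp)+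
  moreover have "((\<lambda>\<sigma>. P \<sigma> (g (t - \<sigma>)) x - main \<sigma>) has_real_derivative 0) (at s within {0..t - a})"
  proof (rule quadratic_remainder_imp_derivative)
    fix \<sigma> assume \<sigma>: "\<sigma> \<in> {0..t - a}"
    have "\<bar>P \<sigma> (g (t - \<sigma>)) x - P \<sigma> G x - (s - \<sigma>) * P \<sigma> G' x\<bar> \<le> K * (\<sigma> - s)\<^sup>2"
    proof (rule P_remainder)
      show "\<bar>g (t - \<sigma>) y - G y - (s - \<sigma>) * G' y\<bar> \<le> K * (\<sigma> - s)\<^sup>2" for y
        using K[of "t - s" "t - \<sigma>" y] \<sigma> s by (simp add: G_def G'_def power2_commute)
    qed (use GB B \<sigma> in auto)
    then show "\<bar>(P \<sigma> (g (t - \<sigma>)) x - main \<sigma>) - (P s (g (t - s)) x - main s) - (\<sigma> - s) * 0\<bar>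
        \<le> K * (\<sigma> - s)\<^sup>2"
      by (simp add: main_def G_def algebra_simps)
  qed
  ultimately have "((\<lambda>\<sigma>. main \<sigma> + (P \<sigma> (g (t - \<sigma>)) x - main \<sigma>)) has_real_derivative
      (L (P s G) x - P s G' x) + 0) (at s within {0..t - a})"
    by (rule DERIV_add)
  moreover have "L (P s G) x - P s G' x = P s (\<lambda>y. L G y - G' y) x"
    using commute[OF GB(1) below[folded G_def], of s x] s integrable_p[OF GB(2), of s x]
    by (simp add: semigroup_op_def)
  ultimately show ?thesis
    by (simp add: G_def G'_def)
qed

section \<open>Regularity of the heat flow\<close>

text \<open>
Each application of \<open>L\<close> uses up a part of the time \<open>c\<close>: after \<open>P\<^bsub>c/2\<^esub>\<close>, the generator yields a
bounded function, so it commutes with the rest of the semigroup. This presents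
\<open>L\<^sup>k P\<^sub>r f\<close> as the flow of a bounded function, and the regularization bounds apply to it as well.
\<close>

lemma iterated_generator_smoothing:
  assumes "f \<in> \<B>" "0 < c"
  shows "\<exists>h\<in>\<B>. \<forall>r\<ge>c. (L ^^ k) (P r f) = P (r - c) h"
  using \<open>0 < c\<close>
proof (induction k arbitrary: c)
  case 0
  have "(L ^^ 0) (P r f) = P (r - c) (P c f)" if "c \<le> r" for r
    using P_semigroup[OF assms(1), of "r - c" c] that 0 by simp
  moreover have "P c f \<in> \<B>"
    using 0 assms by (intro P_B) auto
  ultimately show ?case
    by blast
next
  case (Suc k)
  have c2: "0 < c / 2"
    using Suc.prems by simp
  then obtain h where h: "h \<in> \<B>" "\<And>r. c / 2 \<le> r \<Longrightarrow> (L ^^ k) (P r f) = P (r - c / 2) h"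
    using Suc.IH by blast
  have hB: "P (c / 2) h \<in> \<B>"
    using h(1) c2 by (intro P_B) auto
  obtain C where "\<And>y. \<bar>L (P (c / 2) h) y\<bar> \<le> C"
    using regularizing[OF h(1) c2, of "c / 2"] by auto
  then have LB: "L (P (c / 2) h) \<in> \<B>"
    using D_L[OF B_D[OF hB]] by (intro B_I)
  have "(L ^^ Suc k) (P r f) = P (r - c) (L (P (c / 2) h))" if r: "c \<le> r" for r
  proof -
    have "(L ^^ Suc k) (P r f) = L (P (r - c / 2) h)"
      using h(2)[of r] r c2 by simp
    also have "P (r - c / 2) h = P (r - c) (P (c / 2) h)"
      using P_semigroup[OF h(1), of "r - c" "c / 2"] r c2 by simp
    finally show ?thesis
      using L_P[OF hB LB, of "r - c"] r by simp
  qed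
  with LB show ?case
    by blast
qed

lemma flow_B: "f \<in> \<B> \<Longrightarrow> 0 < r \<Longrightarrow> (L ^^ k) (P r f) \<in> \<B>"
  using iterated_generator_smoothing[of f r k] by (auto intro: P_B)

lemma flow_bounded:
  assumes f: "f \<in> \<B>" and a: "0 < a"
  shows "unif_bounded {a..b} (\<lambda>r. (L ^^ k) (P r f))"
proof -
  obtain h where h: "h \<in> \<B>" "\<And>r. r \<ge> a \<Longrightarrow> (L ^^ k) (P r f) = P (r - a) h"
    using iterated_generator_smoothing[OF f a] by blast
  obtain C where "\<And>y. \<bar>h y\<bar> \<le> C"
    using h(1) B_iff by blast
  then show ?thesis
    using h by (intro unif_bounded_I[of _ _ C]) (auto intro: P_bounds(3))
qed

lemma flow_Gamma_bounded:
  assumes f: "f \<in> \<B>" and a: "0 < a"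
  shows "unif_bounded {a..b} (\<lambda>r. \<Gamma> ((L ^^ j) (P r f)) ((L ^^ k) (P r f)))"
proof -
  have diag: "\<exists>C. \<forall>r\<in>{a..b}. \<forall>y. \<Gamma> ((L ^^ k) (P r f)) ((L ^^ k) (P r f)) y \<le> C" for k
  proof -
    have half_pos: "0 < a / 2"
      using a by simp
    then obtain h where h: "h \<in> \<B>" "\<And>r. r \<ge> a / 2 \<Longrightarrow> (L ^^ k) (P r f) = P (r - a / 2) h"
      using iterated_generator_smoothing[OF f half_pos] by blast
    obtain C where "\<And>s y. s \<in> {a / 2..b} \<Longrightarrow> \<Gamma> (P s h) (P s h) y \<le> C"
      using regularizing[OF h(1), of "a / 2" b] half_pos by blast
    then show ?thesis
      using h(2) a by (intro exI[of _ C]) auto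
  qed
  obtain C D where C: "\<And>r y. r \<in> {a..b} \<Longrightarrow> \<Gamma> ((L ^^ j) (P r f)) ((L ^^ j) (P r f)) y \<le> C"
    and D: "\<And>r y. r \<in> {a..b} \<Longrightarrow> \<Gamma> ((L ^^ k) (P r f)) ((L ^^ k) (P r f)) y \<le> D"
    using diag[of j] diag[of k] by blast
  show ?thesis
  proof (rule unif_bounded_I)
    fix r y assume r: "r \<in> {a..b}"
    show "\<bar>\<Gamma> ((L ^^ j) (P r f)) ((L ^^ k) (P r f)) y\<bar> \<le> (C + D) / 2"
      using Gamma_bound[OF flow_B[OF f, of r j] flow_B[OF f, of r k], of y] r a C[OF r, of y] D[OF r, of y]
      by (simp add: field_simps)
  qed
qed

lemma flow_curve:
  assumes f: "f \<in> \<B>" and a: "0 < a"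
  shows "uniform_curve {a..b} (\<lambda>r. (L ^^ k) (P r f)) (\<lambda>r. (L ^^ Suc k) (P r f))"
proof -
  have D: "((\<lambda>r. (L ^^ k) (P r f) y) has_real_derivative (L ^^ Suc k) (P r f) y) (at r within {a..b})"
    if r: "r \<in> {a..b}" for r y k
  proof -
    obtain h where h: "h \<in> \<B>" "\<And>r. r \<ge> a \<Longrightarrow> (L ^^ k) (P r f) = P (r - a) h"
      using iterated_generator_smoothing[OF f a] by blast
    have "((\<lambda>r. P (r - a) h y) has_real_derivative L (P (r - a) h) y * 1) (at r within {a..b})"
      by (rule DERIV_image_chain[of "\<lambda>s. P s h y" _ "\<lambda>r. r - a" r "{a..b}", unfolded o_def])
        (rule DERIV_subset[OF generator[OF h(1)]] derivative_eq_intros refl | use r in auto)+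
    moreover have "(L ^^ Suc k) (P r f) y = L (P (r - a) h) y * 1"
      using h(2)[of r] r by simp
    ultimately show ?thesis
      using has_field_derivative_transform_within[where d = 1 and a = r and S = "{a..b}" and
          f = "\<lambda>r. P (r - a) h y" and g = "\<lambda>r. (L ^^ k) (P r f) y"] r h(2)
      by simp
  qed
  obtain C where C: "\<And>r y. r \<in> {a..b} \<Longrightarrow> \<bar>(L ^^ Suc (Suc k)) (P r f) y\<bar> \<le> C"
    using flow_bounded[OF f a] unfolding unif_bounded_def by metis
  show ?thesis
    by (rule uniform_curve_I[OF flow_bounded[OF f a] flow_bounded[OF f a]])
      (rule quadratic_taylor_remainder[OF D D C])
qed

text \<open>
Write \<open>u\<^sub>k = L\<^sup>k P\<^sub>r f\<close>, so that \<open>u\<^sub>k' = u\<^sub>k\<^sub>+\<^sub>1\<close> in time. As \<open>\<Gamma>(u\<^sub>0) = (L(u\<^sub>0\<^sup>2) - 2 * u\<^sub>0 * u\<^sub>1) / 2\<close>, only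
the curve \<open>L(u\<^sub>0\<^sup>2)\<close> needs an argument. It needs a bound on \<open>L\<close> of the second time derivative of \<open>u\<^sub>0\<^sup>2\<close>,
which involves \<open>u\<^sub>0, \<dots>, u\<^sub>3\<close> and their carre du champ.
\<close>

lemma flow_Gamma_curve:
  assumes f: "f \<in> \<B>" and a: "0 < a"
  shows "uniform_curve {a..b} (\<lambda>r. \<Gamma> (P r f) (P r f)) (\<lambda>r y. 2 * \<Gamma> (P r f) (L (P r f)) y)"
proof -
  define u where "u k r = (L ^^ k) (P r f)" for k r
  have Lu012: "L (u 0 r) = u 1 r" "L (u 1 r) = u 2 r" "L (u 2 r) = u 3 r" for r
    by (simp_all add: u_def numeral_2_eq_2 numeral_3_eq_3)
  have uB: "u k r \<in> \<B>" if "r \<in> {a..b}" for k r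
    unfolding u_def by (rule flow_B[OF f]) (use that a in auto)
  have uD: "u k r \<in> \<D>" if "r \<in> {a..b}" for k r
    using uB[OF that] B_D by blast
  have curve: "uniform_curve {a..b} (u k) (u (Suc k))" for k
    unfolding u_def using flow_curve[OF f a] by blast
  have bd: "unif_bounded {a..b} (u k)" "unif_bounded {a..b} (\<lambda>r. \<Gamma> (u j r) (u k r))" for j k
    unfolding u_def using flow_bounded[OF f a] flow_Gamma_bounded[OF f a] by blast+
  have c0: "uniform_curve {a..b} (u 0) (u 1)" and c1: "uniform_curve {a..b} (u 1) (u 2)"
    using curve[of 0] curve[of 1] by (simp_all add: numeral_2_eq_2)
  define g where "g r y = u 0 r y * u 0 r y" for r y
  define g' where "g' r y = u 1 r y * u 0 r y + u 0 r y * u 1 r y" for r y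
  define g'' where "g'' r y = (u 2 r y * u 0 r y + u 1 r y * u 1 r y) +
    (u 1 r y * u 1 r y + u 0 r y * u 2 r y)" for r y
  have c: "uniform_curve {a..b} g g'" "uniform_curve {a..b} g' g''"
    unfolding g_def g'_def g''_def
    by (intro uniform_curve_add uniform_curve_mult c0 c1)+
  have Lg: "L (g r) = (\<lambda>y. u 0 r y * u 1 r y + u 0 r y * u 1 r y + 2 * \<Gamma> (u 0 r) (u 0 r) y)" for r
    unfolding g_def by (rule ext, subst L_mult) (simp add: Lu012)
  have Lg': "L (g' r) y = 2 * (u 0 r y * u 2 r y + u 1 r y * u 1 r y + 2 * \<Gamma> (u 0 r) (u 1 r) y)"
    if r: "r \<in> {a..b}" for r y
    unfolding g'_def using uD[OF r]
    by (simp add: L_add D_intros L_mult L_const Gamma_const_left Lu012 Gamma_sym[of "u 1 r" "u 0 r"] del: One_nat_def)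
  have Lg'': "L (g'' r) y = 2 * (u 0 r y * u 3 r y + u 2 r y * u 1 r y + 2 * \<Gamma> (u 0 r) (u 2 r) y) +
      2 * (u 1 r y * u 2 r y + u 1 r y * u 2 r y + 2 * \<Gamma> (u 1 r) (u 1 r) y)"
    if r: "r \<in> {a..b}" for r y
    unfolding g''_def using uD[OF r]
    by (simp add: L_add D_intros L_mult L_const Gamma_const_left Lu012 Gamma_sym[of "u 2 r" "u 0 r"] del: One_nat_def)
  have bds: "unif_bounded {a..b} (\<lambda>r. L (g r))" "unif_bounded {a..b} (\<lambda>r. L (g' r))"
    "unif_bounded {a..b} (\<lambda>r. L (g'' r))"
    unfolding Lg
    by (intro unif_bounded_add unif_bounded_mult unif_bounded_const bd |
        subst unif_bounded_cong[OF Lg'] unif_bounded_cong[OF Lg''], assumption)+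
  have "uniform_curve {a..b} (\<lambda>r. L (g r)) (\<lambda>r. L (g' r))"
    by (rule uniform_curve_L[OF c _ bds])
      (unfold g_def g'_def g''_def, use uB in \<open>auto intro!: B_intros\<close>)
  then have "uniform_curve {a..b}
      (\<lambda>r y. (1/2) * (L (g r) y + (- 2) * (u 0 r y * u 1 r y)))
      (\<lambda>r y. (1/2) * (L (g' r) y + (- 2) * (u 1 r y * u 1 r y + u 0 r y * u 2 r y)))"
    by (intro uniform_curve_cmult uniform_curve_add uniform_curve_mult c0 c1)
  then have "uniform_curve {a..b} (\<lambda>r. \<Gamma> (u 0 r) (u 0 r)) (\<lambda>r y. 2 * \<Gamma> (u 0 r) (u 1 r) y)"
    by (rule uniform_curve_cong) (simp_all add: Lg Lg' algebra_simps)
  then show ?thesis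
    by (simp add: u_def)
qed


section \<open>Entropy and Fisher information along the flow\<close>

lemma flow_Gamma_B:
  assumes "f \<in> \<B>" "0 < r"
  shows "\<Gamma> ((L ^^ j) (P r f)) ((L ^^ k) (P r f)) \<in> \<B>"
proof -
  obtain C where "\<And>y. \<bar>\<Gamma> ((L ^^ j) (P r f)) ((L ^^ k) (P r f)) y\<bar> \<le> C"
    using flow_Gamma_bounded[OF assms, where b = r] unfolding unif_bounded_def by (metis atLeastAtMost_iff order_refl)
  then show ?thesis
    using flow_B[OF assms] by (intro B_I Gamma_D) (auto dest: B_D)
qed

text \<open>
The exponential, rather than \<open>ln\<close>, carries the calculus: once \<open>w = ln u\<close> is known to lie in the algebra,
everything follows from \<open>u = exp w\<close>.
\<close>

lemma log_flow:
  fixes f :: "'a \<Rightarrow> real" and r :: real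
  assumes f: "f \<in> \<B>" and \<epsilon>: "0 < \<epsilon>" "\<And>y. \<epsilon> \<le> f y" and r: "0 < r"
  defines "u \<equiv> P r f" and "w \<equiv> \<lambda>y. ln (P r f y)"
  shows "\<epsilon> \<le> u y" and "(\<lambda>y. exp (w y)) = u" and "w \<in> \<B>" and "(\<lambda>y. 1 / u y) \<in> \<B>"
    and "\<Gamma> u w y = u y * \<Gamma> w w y" and "\<Gamma> u u y = (u y)\<^sup>2 * \<Gamma> w w y"
    and "L u y = u y * (L w y + \<Gamma> w w y)"
    and "\<Gamma> w w \<in> \<B>" and "L w \<in> \<B>"
proof -
  have uB: "u \<in> \<B>"
    using flow_B[OF f r, of 0] by (simp add: u_def)
  show lower: "\<epsilon> \<le> u y" for y
    unfolding u_def using r \<epsilon> by (intro P_bounds(1) f) auto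
  then have pos: "0 < u y" for y
    using \<epsilon>(1) less_le_trans by blast
  show u: "(\<lambda>y. exp (w y)) = u"
    using pos by (simp add: w_def u_def)
  obtain C where C: "\<And>y. \<bar>u y\<bar> \<le> C"
    using uB B_iff by blast
  show wB: "w \<in> \<B>"
  proof (rule B_I)
    show "w \<in> \<D>"
      unfolding w_def using D_smooth[OF B_D[OF uB] smooth_ln] pos by (auto simp: u_def)
    fix y
    have "ln \<epsilon> \<le> w y" "w y \<le> ln C"
      using lower[of y] pos[of y] C[of y] \<epsilon>(1) by (auto simp: w_def u_def)
    then show "\<bar>w y\<bar> \<le> max \<bar>ln \<epsilon>\<bar> \<bar>ln C\<bar>"
      by linarith
  qed
  have inv: "(\<lambda>y. 1 / u y) = (\<lambda>y. exp (- 1 * w y))"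
    using u by (auto simp: exp_minus inverse_eq_divide fun_eq_iff)
  show invB: "(\<lambda>y. 1 / u y) \<in> \<B>"
    unfolding inv by (rule B_comp_smooth[OF B_cmult[OF wB] smooth_exp])
  have G: "\<Gamma> u h y = u y * \<Gamma> w h y" if "h \<in> \<B>" for h y
    using Gamma_exp_left[OF wB that, of y] u by (simp add: fun_eq_iff)
  show uw: "\<Gamma> u w y = u y * \<Gamma> w w y" for y
    by (rule G[OF wB])
  show uu: "\<Gamma> u u y = (u y)\<^sup>2 * \<Gamma> w w y" for y
    using G[OF uB, of y] uw[of y] Gamma_sym[of w u y] by (simp add: power2_eq_square)
  show Lu: "L u y = u y * (L w y + \<Gamma> w w y)" for y
    using L_exp[OF B_D[OF wB], of y] u by (simp add: fun_eq_iff)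
  have "\<Gamma> u u \<in> \<B>"
    using flow_Gamma_B[OF f r, of 0 0] by (simp add: u_def)
  then have "(\<lambda>y. \<Gamma> u u y * ((1 / u y) * (1 / u y))) \<in> \<B>"
    by (intro B_mult invB)
  also have "(\<lambda>y. \<Gamma> u u y * ((1 / u y) * (1 / u y))) = \<Gamma> w w"
    using pos uu by (simp add: fun_eq_iff power2_eq_square order_less_imp_not_eq2)
  finally show GwB: "\<Gamma> w w \<in> \<B>" .
  have "L u \<in> \<B>"
    using flow_B[OF f r, of 1] by (simp add: u_def)
  then have "(\<lambda>y. L u y * (1 / u y) - \<Gamma> w w y) \<in> \<B>"
    by (intro B_diff B_mult invB GwB)
  also have "(\<lambda>y. L u y * (1 / u y) - \<Gamma> w w y) = L w"
    using pos Lu by (simp add: fun_eq_iff order_less_imp_not_eq2)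
  finally show "L w \<in> \<B>" .
qed

lemma at_within_Ico_eq_Icc:
  fixes s b t :: real
  assumes "s < b" "b \<le> t"
  shows "at s within {0..b} = at s within {0..<t}"
  by (rule at_within_nhd[where S = "{..<b}"]) (use assms in auto)

text \<open>
As \<open>v = P\<^bsub>t - \<sigma>\<^esub> f\<close> runs backwards in time, \<open>(1 + ln v) * L v\<close> cancels between \<open>L (v * ln v)\<close> and the time
derivative of \<open>v * ln v\<close>. There remains the second-order term of the diffusion property.
In the proof, \<open>a\<close> is any time strictly between \<open>0\<close> and \<open>t - s\<close>: the bounds on the flow are uniform only
away from time \<open>0\<close>.
\<close>

lemma entropy_derivative:
  assumes f: "f \<in> \<B>" and \<epsilon>: "0 < \<epsilon>" "\<And>y. \<epsilon> \<le> f y" and s: "s \<in> {0..<t}"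
  shows "((\<lambda>\<sigma>. P \<sigma> (\<lambda>y. P (t - \<sigma>) f y * ln (P (t - \<sigma>) f y)) x) has_real_derivative
    P s (\<lambda>y. \<Gamma> (P (t - s) f) (P (t - s) f) y / P (t - s) f y) x) (at s within {0..<t})"
proof -
  define a where "a = (t - s) / 2"
  have a: "0 < a" "s < t - a" "t - a \<le> t"
    using s by (auto simp: a_def field_simps)
  define g where "g r y = P r f y * ln (P r f y)" for r y
  define g' where "g' r y = L (P r f) y * ln (P r f y) + P r f y * (1 / P r f y * L (P r f) y)" for r y
  note flow = log_flow[OF f \<epsilon>]
  have c0: "uniform_curve {a..t} (\<lambda>r. P r f) (\<lambda>r. L (P r f))"
    using flow_curve[OF f a(1), where k = 0] by simp
  have "uniform_curve {a..t} g g'"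
    unfolding g_def g'_def
    by (intro uniform_curve_mult c0 uniform_curve_ln[OF c0 \<epsilon>(1)] flow(1)) (use a in auto)
  moreover have gB: "g r \<in> \<B>" and g'B: "g' r \<in> \<B>" if "0 < r" for r
  proof -
    have uB: "P r f \<in> \<B>" "L (P r f) \<in> \<B>"
      using flow_B[OF f that, of 0] flow_B[OF f that, of 1] by simp_all
    show "g r \<in> \<B>"
      unfolding g_def by (intro B_mult uB flow(3)[OF that])
    show "g' r \<in> \<B>"
      unfolding g'_def by (intro B_add B_mult uB flow(3,4)[OF that])
  qed
  have r: "0 < t - s"
    using s by simp
  define u where "u = P (t - s) f"
  define w where "w y = ln (u y)" for y
  note flow = flow[OF r, folded u_def, folded w_def]
  have pos: "0 < u y" for y
    using flow(1)[of y] \<epsilon>(1) by linarith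
  have uB: "u \<in> \<B>" and LuB: "L u \<in> \<B>"
    using flow_B[OF f r, of 0] flow_B[OF f r, of 1] by (simp_all add: u_def)
  have g_s: "g (t - s) = (\<lambda>y. u y * w y)"
    by (simp add: g_def u_def w_def fun_eq_iff)
  have Lg: "L (g (t - s)) = (\<lambda>y. (1 + w y) * L u y + u y * \<Gamma> w w y)"
    unfolding g_s by (rule ext, subst L_mult) (simp add: flow algebra_simps)
  have "L (g (t - s)) \<in> \<B>"
    unfolding Lg by (intro B_intros uB LuB flow)
  then have below: "bdd_below (range (L (g (t - s))))"
    by (rule B_bdd_below)
  have "(\<lambda>y. L (g (t - s)) y - g' (t - s) y) = (\<lambda>y. \<Gamma> u u y / u y)"
    unfolding Lg g'_def u_def[symmetric] w_def[symmetric]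
    using pos by (simp add: fun_eq_iff flow(6) power2_eq_square order_less_imp_not_eq2 algebra_simps)
  ultimately show ?thesis
    using moving_integrand_derivative[of a t g g' s x] gB g'B below a s at_within_Ico_eq_Icc[OF a(2,3)]
    by (simp add: u_def g_def[abs_def])
qed

text \<open>
The Bochner identity gives the derivative \<open>2 * P\<^sub>s (u * \<Gamma>\<^sub>2(ln u)) x\<close>. In the curvature-dimension
inequality, \<open>(L w)\<^sup>2\<close> is bounded below by its tangent \<open>2 * \<alpha> * L w - \<alpha>\<^sup>2\<close> at the constant
\<open>\<alpha> = X - \<lambda>\<close>. This is the optimal choice, with the same effect as the Cauchy-Schwarz inequality, and leaves
only integrals that are known: \<open>P\<^sub>s u\<close>, \<open>P\<^sub>s (L u)\<close> and \<open>P\<^sub>s (u * \<Gamma>(w))\<close>.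
\<close>

lemma fisher_information_derivative:
  fixes x :: 'a and \<rho> n :: real
  assumes f: "f \<in> \<B>" and \<epsilon>: "0 < \<epsilon>" "\<And>y. \<epsilon> \<le> f y" and s: "s \<in> {0..<t}"
    and CD: "curvature_dimension \<D> L \<rho> n" and n: "0 < n"
  defines "\<Lambda> \<equiv> \<lambda>\<sigma>. P \<sigma> (\<lambda>y. \<Gamma> (P (t - \<sigma>) f) (P (t - \<sigma>) f) y / P (t - \<sigma>) f y) x"
  shows "\<exists>D. (\<Lambda> has_real_derivative D) (at s within {0..<t}) \<and>
    D / P t f x \<ge> 2 * \<rho> * (\<Lambda> s / P t f x) + 2 / n * (L (P t f) x / P t f x - \<Lambda> s / P t f x)\<^sup>2"
proof -
  define a where "a = (t - s) / 2"
  have a: "0 < a" "s < t - a" "t - a \<le> t"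
    using s by (auto simp: a_def field_simps)
  define g where "g r y = \<Gamma> (P r f) (P r f) y * (1 / P r f y)" for r y
  define g' where "g' r y = 2 * \<Gamma> (P r f) (L (P r f)) y * (1 / P r f y) +
    \<Gamma> (P r f) (P r f) y * (- 1 / (P r f y)\<^sup>2 * L (P r f) y)" for r y
  note flow = log_flow[OF f \<epsilon>]
  have c0: "uniform_curve {a..t} (\<lambda>r. P r f) (\<lambda>r. L (P r f))"
    using flow_curve[OF f a(1), where k = 0] by simp
  have curve: "uniform_curve {a..t} g g'"
    unfolding g_def g'_def
    by (intro uniform_curve_mult flow_Gamma_curve[OF f a(1)] uniform_curve_inverse[OF c0 \<epsilon>(1)] flow(1))
      (use a in auto)
  have gB: "g r \<in> \<B>" and g'B: "g' r \<in> \<B>" if "0 < r" for r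
  proof -
    note G = flow_Gamma_B[OF f that, of 0 0] flow_Gamma_B[OF f that, of 0 1]
      flow_B[OF f that, of 1] flow(4)[OF that]
    show "g r \<in> \<B>"
      unfolding g_def using G by (intro B_mult) auto
    have "(\<lambda>y. 2 * \<Gamma> (P r f) (L (P r f)) y * (1 / P r f y) +
        \<Gamma> (P r f) (P r f) y * (- 1 * ((1 / P r f y) * (1 / P r f y)) * L (P r f) y)) \<in> \<B>"
      using G by (intro B_add B_mult B_const) auto
    then show "g' r \<in> \<B>"
      by (simp add: g'_def[abs_def] power2_eq_square)
  qed
  have r: "0 < t - s"
    using s by simp
  define u where "u = P (t - s) f"
  define w where "w y = ln (u y)" for y
  note flow = flow[OF r, folded u_def, folded w_def]
  have pos: "0 < u y" for y
    using flow(1)[of y] \<epsilon>(1) by linarith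
  have uB: "u \<in> \<B>" and LuB: "L u \<in> \<B>"
    using flow_B[OF f r, of 0] flow_B[OF f r, of 1] by (simp_all add: u_def)
  have g_s: "g (t - s) = (\<lambda>y. u y * \<Gamma> w w y)"
    using pos by (simp add: g_def u_def[symmetric] fun_eq_iff flow(6) power2_eq_square order_less_imp_not_eq2)
  have bochner: "L (g (t - s)) y - g' (t - s) y = 2 * u y * Gamma2 L w y" for y
    using fisher_information_bochner[OF flow(3,9,8), of y] flow(2)
    by (simp add: g_s g'_def u_def[symmetric] fun_eq_iff)
  have CD_w: "\<rho> * \<Gamma> w w y + (1 / n) * (L w y)\<^sup>2 \<le> Gamma2 L w y" for y
    using CD flow(3) by (simp add: curvature_dimension_def)
  have lower: "2 * u y * (\<rho> * \<Gamma> w w y) + g' (t - s) y \<le> L (g (t - s)) y" for y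
  proof -
    have "\<rho> * \<Gamma> w w y \<le> Gamma2 L w y"
      using CD_w[of y] n zero_le_power2[of "L w y"] by (smt (verit) divide_nonneg_pos mult_nonneg_nonneg zero_less_one)
    then have "2 * u y * (\<rho> * \<Gamma> w w y) \<le> 2 * u y * Gamma2 L w y"
      using pos[of y] by (intro mult_left_mono) auto
    then show ?thesis
      using bochner[of y] by simp
  qed
  have "(\<lambda>y. 2 * u y * (\<rho> * \<Gamma> w w y) + g' (t - s) y) \<in> \<B>"
    by (intro B_add B_mult B_const uB flow g'B r)
  from B_bound[OF this]
  obtain C where C: "\<And>y. \<bar>2 * u y * (\<rho> * \<Gamma> w w y) + g' (t - s) y\<bar> \<le> C"
    by blast
  have below: "bdd_below (range (L (g (t - s))))"
  proof (rule bdd_belowI)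
    fix z assume "z \<in> range (L (g (t - s)))"
    then obtain y where "z = L (g (t - s)) y"
      by blast
    then show "- C \<le> z"
      using C[of y] lower[of y] by linarith
  qed
  have int: "integrable (p s x) (\<lambda>y. 2 * u y * Gamma2 L w y)"
    using commute[OF gB[OF r] below, of s x] integrable_p[OF g'B[OF r], of s x] s
    by (simp flip: bochner)
  define D where "D = P s (\<lambda>y. 2 * u y * Gamma2 L w y) x"
  have \<Lambda>_eq: "\<Lambda> = (\<lambda>\<sigma>. P \<sigma> (g (t - \<sigma>)) x)"
    by (simp add: \<Lambda>_def g_def[abs_def])
  have deriv: "(\<Lambda> has_real_derivative D) (at s within {0..<t})"
    using moving_integrand_derivative[OF curve _ _ below, of x] gB g'B a s at_within_Ico_eq_Icc[OF a(2,3)]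
    by (simp add: \<Lambda>_eq D_def bochner)
  define h where "h = P t f x"
  have h: "P s u x = h"
    using P_semigroup[OF f, of s "t - s"] s by (simp add: u_def h_def)
  have h_pos: "0 < h"
    using P_bounds(1)[OF f, of t \<epsilon> x] \<epsilon> s by (simp add: h_def)
  define X where "X = L (P t f) x / h"
  have Lh: "P s (L u) x = X * h"
    using L_P[OF uB LuB, of s] P_semigroup[OF f, of s "t - s"] s h_pos by (simp add: u_def X_def)
  define l where "l = \<Lambda> s / h"
  have s0: "0 \<le> s"
    using s by simp
  have low: "2 * \<rho> * (u y * \<Gamma> w w y) + 2 / n * (2 * (X - l) * (L u y - u y * \<Gamma> w w y) - (X - l)\<^sup>2 * u y)
      \<le> 2 * u y * Gamma2 L w y" for y
  proof -
    have "2 * (X - l) * L w y - (X - l)\<^sup>2 \<le> (L w y)\<^sup>2"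
      using zero_le_power2[of "L w y - (X - l)"] by (simp add: power2_eq_square algebra_simps)
    then have "1 / n * (2 * (X - l) * L w y - (X - l)\<^sup>2) \<le> 1 / n * (L w y)\<^sup>2"
      using n by (intro mult_left_mono) auto
    then have "\<rho> * \<Gamma> w w y + 1 / n * (2 * (X - l) * L w y - (X - l)\<^sup>2) \<le> Gamma2 L w y"
      using CD_w[of y] by linarith
    then have "2 * u y * (\<rho> * \<Gamma> w w y + 1 / n * (2 * (X - l) * L w y - (X - l)\<^sup>2)) \<le> 2 * u y * Gamma2 L w y"
      using pos[of y] by (intro mult_left_mono) auto
    then show ?thesis
      by (simp add: flow(7)[of y] algebra_simps)
  qed
  have vG: "(\<lambda>y. u y * \<Gamma> w w y) \<in> \<B>"
    by (intro B_mult uB flow)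
  have P_linear: "P s (\<lambda>y. a * (u y * \<Gamma> w w y) + b * (c * (L u y - u y * \<Gamma> w w y) - d * u y)) x =
      a * P s (\<lambda>y. u y * \<Gamma> w w y) x +
      b * (c * (P s (L u) x - P s (\<lambda>y. u y * \<Gamma> w w y) x) - d * P s u x)" for a b c d
    by (simp only: P_add P_diff P_cmult s0 B_add B_diff B_cmult vG uB LuB)
  have l: "P s (\<lambda>y. u y * \<Gamma> w w y) x = l * h"
    using h_pos by (simp add: l_def \<Lambda>_eq g_s)
  have "P s (\<lambda>y. 2 * \<rho> * (u y * \<Gamma> w w y) +
        2 / n * (2 * (X - l) * (L u y - u y * \<Gamma> w w y) - (X - l)\<^sup>2 * u y)) x \<le> D"
    unfolding D_def
    by (rule P_mono[OF _ int low], rule integrable_p[OF _ s0]) (intro B_intros vG uB LuB)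
  also have "P s (\<lambda>y. 2 * \<rho> * (u y * \<Gamma> w w y) +
        2 / n * (2 * (X - l) * (L u y - u y * \<Gamma> w w y) - (X - l)\<^sup>2 * u y)) x =
      2 * \<rho> * (l * h) + 2 / n * (2 * (X - l) * (X * h - l * h) - (X - l)\<^sup>2 * h)"
    unfolding P_linear l h Lh ..
  also have "\<dots> = (2 * \<rho> * l + 2 / n * (X - l)\<^sup>2) * h"
    by (simp add: algebra_simps power2_eq_square)
  finally have "2 * \<rho> * l + 2 / n * (X - l)\<^sup>2 \<le> D / h"
    using h_pos by (simp add: le_divide_eq)
  with deriv show ?thesis
    by (auto simp: l_def X_def h_def)
qed


lemma P_positive:
  assumes f: "f \<in> \<B>" and pos: "\<And>y. 0 < f y" and t: "0 \<le> t"
  shows "0 < P t f x"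
proof -
  interpret prob_space "p t x"
    by (rule prob_p[OF t])
  have "0 \<le> P t f x"
    by (rule P_bounds(1)[OF f t]) (use pos less_imp_le in blast)
  moreover have "P t f x \<noteq> 0"
  proof
    assume "P t f x = 0"
    then have "AE y in p t x. f y = 0"
      using integral_nonneg_eq_0_iff_AE[OF integrable_p[OF f t, of x]] pos
      by (simp add: semigroup_op_def less_imp_le)
    then have "AE y in p t x. False"
      by eventually_elim (use pos less_irrefl in metis)
    then show False
      by simp
  qed
  ultimately show ?thesis
    by simp
qed

lemma entropy_bound:
  fixes z M :: real
  assumes "0 < z" "z \<le> M" "1 \<le> M"
  shows "\<bar>z * ln z\<bar> \<le> M\<^sup>2"
proof -
  have M: "1 \<le> M\<^sup>2"
    using assms(3) by simp
  have "ln (1 / z) \<le> 1 / z - 1"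
    using assms(1) by (intro ln_le_minus_one) simp
  then have "z * ln (1 / z) \<le> z * (1 / z - 1)"
    using assms(1) by (intro mult_left_mono) auto
  also have "\<dots> = 1 - z"
    using assms(1) by (simp add: right_diff_distrib)
  finally have "- (z * ln z) \<le> M\<^sup>2"
    using assms(1) M by (simp add: ln_div)
  moreover have "z * ln z \<le> z * z"
    using assms(1) ln_le_minus_one[of z] by (intro mult_left_mono) auto
  then have "z * ln z \<le> M * M"
    using mult_mono[OF assms(2) assms(2)] assms by linarith
  ultimately show ?thesis
    by (simp add: abs_le_iff power2_eq_square)
qed

text \<open>
Adding a constant \<open>e > 0\<close> to \<open>f\<close> changes neither \<open>L P\<^sub>t f\<close> nor \<open>\<Gamma>(P\<^sub>t f)\<close> and makes the logarithm bounded. For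
\<open>e \<le> 1\<close> the normalized entropy is bounded independently of \<open>e\<close>, by \<open>(C + 1)\<^sup>2 / P\<^sub>t f x\<close>.
\<close>

lemma li_yau_comparison:
  fixes x :: 'a and \<rho> n t T :: real and S S' :: "real \<Rightarrow> real"
  assumes f: "f \<in> \<B>" and f_pos: "\<And>y. 0 < f y"
    and CD: "curvature_dimension \<D> L \<rho> n" and n: "0 < n" and T: "0 < T" "T \<le> t"
  defines "X \<equiv> L (P t f) x / P t f x"
  assumes S: "\<And>s. (S has_real_derivative S' s) (at s)"
    and S': "\<And>s. (S' has_real_derivative (\<rho>\<^sup>2 - 4 * \<rho> / n * X) * S s) (at s)"
    and S_nonneg: "\<And>s. s \<in> {0..T} \<Longrightarrow> 0 \<le> S s" and ST: "S T = 0"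
    and S_start: "0 < S 0 \<or> 0 < S' 0"
  shows "S' 0 + 2 / n * (\<Gamma> (P t f) (P t f) x / (P t f x)\<^sup>2 + n * \<rho> / 2 - X) * S 0 < 0"
proof -
  have t: "0 < t"
    using T by simp
  obtain C where C: "0 \<le> C" "\<And>y. \<bar>f y\<bar> \<le> C"
    using B_bound[OF f] by blast
  define h where "h = P t f x"
  have h: "0 < h"
    unfolding h_def using t by (intro P_positive f f_pos) auto
  define F where "F e y = f y + e" for e y
  have F: "F e \<in> \<B>" for e
    unfolding F_def by (intro B_add B_const f)
  have F_lower: "e \<le> F e y" for e y
    using f_pos[of y] by (simp add: F_def)
  have PF: "P r (F e) = (\<lambda>y. P r f y + e)" if "0 \<le> r" for r e
    unfolding F_def using that by (simp add: fun_eq_iff P_add[OF f B_const] P_const)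
  have PD: "P t f \<in> \<D>"
    using P_B[OF f] t B_D by simp
  have PtF: "P t (F e) x = h + e" "L (P t (F e)) x = L (P t f) x"
    "\<Gamma> (P t (F e)) (P t (F e)) x = \<Gamma> (P t f) (P t f) x" for e
    using t PD by (simp_all add: PF h_def L_add D_const L_const Gamma_add_left Gamma_add_right D_add
        Gamma_const_left Gamma_const_right)
  define ent where "ent e s = P s (\<lambda>y. P (t - s) (F e) y * ln (P (t - s) (F e) y)) x" for e s
  define fis where "fis e s =
    P s (\<lambda>y. \<Gamma> (P (t - s) (F e)) (P (t - s) (F e)) y / P (t - s) (F e) y) x" for e s
  have "\<forall>e s. \<exists>D. 0 < e \<and> s \<in> {0..<t} \<longrightarrow>
      (fis e has_real_derivative D) (at s within {0..<t}) \<and>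
      D / (h + e) \<ge> 2 * \<rho> * (fis e s / (h + e)) +
        2 / n * (L (P t f) x / (h + e) - fis e s / (h + e))\<^sup>2"
    using fisher_information_derivative[OF F _ F_lower _ CD n, of _ _ t x, unfolded PtF]
    unfolding fis_def by blast
  then obtain D where D: "\<And>e s. 0 < e \<Longrightarrow> s \<in> {0..<t} \<Longrightarrow>
      (fis e has_real_derivative D e s) (at s within {0..<t}) \<and>
      D e s / (h + e) \<ge> 2 * \<rho> * (fis e s / (h + e)) +
        2 / n * (L (P t f) x / (h + e) - fis e s / (h + e))\<^sup>2"
    by metis
  have fis_0: "fis e 0 / (h + e) = \<Gamma> (P t f) (P t f) x / (h + e)\<^sup>2" if e: "0 < e" for e
  proof -
    have "(\<lambda>y. \<Gamma> (P t (F e)) (P t (F e)) y * (1 / P t (F e) y)) \<in> \<B>"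
      using flow_Gamma_B[OF F[of e] t, of 0 0] log_flow(4)[OF F e F_lower t] by (intro B_mult) auto
    then have "fis e 0 = \<Gamma> (P t (F e)) (P t (F e)) x / P t (F e) x"
      using P_0[OF B_D] by (simp add: fis_def)
    then show ?thesis
      by (simp add: PtF power2_eq_square)
  qed
  have ent_bound: "\<bar>ent e s / (h + e)\<bar> \<le> (C + 1)\<^sup>2 / h" if e: "0 < e" "e \<le> 1" and s: "s \<in> {0..<t}" for e s
  proof -
    have r: "0 < t - s"
      using s by simp
    have "P (t - s) (F e) y \<le> C + 1" for y
      using P_bounds(2)[OF f, of "t - s" C y] C(2) r e
      by (simp add: PF) (smt (verit) abs_ge_self)
    moreover have "0 < P (t - s) (F e) y" for y
      using log_flow(1)[OF F e(1) F_lower r, of y] e by linarith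
    ultimately have "\<bar>P (t - s) (F e) y * ln (P (t - s) (F e) y)\<bar> \<le> (C + 1)\<^sup>2" for y
      using C(1) by (intro entropy_bound) auto
    moreover have "(\<lambda>y. P (t - s) (F e) y * ln (P (t - s) (F e) y)) \<in> \<B>"
      using flow_B[OF F r, of 0] log_flow(3)[OF F e(1) F_lower r] by (intro B_mult) auto
    ultimately have "\<bar>ent e s\<bar> \<le> (C + 1)\<^sup>2"
      unfolding ent_def using s by (intro P_bounds(3)) auto
    then have "\<bar>ent e s\<bar> / (h + e) \<le> (C + 1)\<^sup>2 / h"
      using h e by (intro frac_le) auto
    then show ?thesis
      using h e by simp
  qed
  have "S' 0 + 2 / n * (\<Gamma> (P t f) (P t f) x / h\<^sup>2 + n * \<rho> / 2 - L (P t f) x / h) * S 0 < 0"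
  proof (rule riccati_bound[OF T n _ _ _ ent_bound, where lam = "\<lambda>e s. fis e s / (h + e)"
        and lam' = "\<lambda>e s. D e s / (h + e)" and X = "\<lambda>e. L (P t f) x / (h + e)"
        and A = "\<bar>L (P t f) x\<bar> / h"])
    fix e s :: real assume e: "0 < e" "e \<le> 1" and s: "s \<in> {0..<t}"
    show "((\<lambda>s. ent e s / (h + e)) has_real_derivative fis e s / (h + e)) (at s within {0..<t})"
      unfolding ent_def fis_def by (intro DERIV_cdivide entropy_derivative[OF F e(1) F_lower s])
    show "((\<lambda>s. fis e s / (h + e)) has_real_derivative D e s / (h + e)) (at s within {0..<t})"
      using D[OF e(1) s] by (intro DERIV_cdivide) simp
    show "D e s / (h + e) \<ge> 2 * \<rho> * (fis e s / (h + e)) +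
        2 / n * (L (P t f) x / (h + e) - fis e s / (h + e))\<^sup>2"
      using D[OF e(1) s] by simp
  next
    fix e :: real assume "0 < e"
    then show "\<bar>L (P t f) x / (h + e)\<bar> \<le> \<bar>L (P t f) x\<bar> / h"
      using h by (simp add: abs_divide frac_le)
  next
    have "((\<lambda>e. L (P t f) x / (h + e)) \<longlongrightarrow> L (P t f) x / (h + 0)) (at_right 0)"
      using h by (intro tendsto_intros) auto
    then show "((\<lambda>e. L (P t f) x / (h + e)) \<longlongrightarrow> L (P t f) x / h) (at_right 0)"
      by simp
    have "((\<lambda>e. \<Gamma> (P t f) (P t f) x / (h + e)\<^sup>2) \<longlongrightarrow> \<Gamma> (P t f) (P t f) x / (h + 0)\<^sup>2) (at_right 0)"
      using h by (intro tendsto_intros) auto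
    moreover have "\<forall>\<^sub>F e in at_right 0. \<Gamma> (P t f) (P t f) x / (h + e)\<^sup>2 = fis e 0 / (h + e)"
      using eventually_at_right_less[of "0::real"] by eventually_elim (simp add: fis_0)
    ultimately show "((\<lambda>e. fis e 0 / (h + e)) \<longlongrightarrow> \<Gamma> (P t f) (P t f) x / h\<^sup>2) (at_right 0)"
      using Lim_transform_eventually by fastforce
  qed (use S S' S_nonneg ST S_start in \<open>simp_all add: X_def h_def\<close>)
  then show ?thesis
    by (simp add: X_def h_def)
qed

end

section \<open>The Li-Yau inequality\<close>

text \<open>
In the comparison functions \<open>\<kappa> * sinh (\<kappa> * (t - s))\<close> and \<open>\<kappa> * sin (\<kappa> * (t - s))\<close>, the factor \<open>\<kappa>\<close>, which
has the sign of \<open>\<rho>\<close>, makes the function nonnegative for either sign. The scaled inequality is divided by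
\<open>\<kappa>\<close> again here.
\<close>

lemma divide_square_scale:
  fixes \<kappa> A B Y :: real
  assumes "- (\<kappa>\<^sup>2 * A) + Y * (\<kappa> * B) < 0" and "0 < \<kappa> * B"
  shows "Y < \<kappa> * (A / B)"
proof -
  have "B \<noteq> 0"
    using assms(2) by auto
  then have "Y * (\<kappa> * B) < \<kappa> * (A / B) * (\<kappa> * B)"
    using assms(1) by (simp add: power2_eq_square mult.commute mult.left_commute)
  then show ?thesis
    using mult_less_cancel_right_pos[OF assms(2)] by blast
qed

lemma mult_sinh_pos: "\<kappa> \<noteq> 0 \<Longrightarrow> 0 < a \<Longrightarrow> 0 < \<kappa> * sinh (\<kappa> * a)" for \<kappa> a :: real
  by (cases "0 < \<kappa>") (auto simp: zero_less_mult_iff mult_neg_pos)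

lemma mult_sin_pos:
  fixes \<kappa> a :: real
  assumes "\<kappa> \<noteq> 0" "0 < a" "\<bar>\<kappa>\<bar> * a < pi"
  shows "0 < \<kappa> * sin (\<kappa> * a)"
proof (cases "0 < \<kappa>")
  case True
  then show ?thesis
    using assms by (intro mult_pos_pos sin_gt_zero) auto
next
  case False
  then have "0 < sin (- \<kappa> * a)"
    using assms by (intro sin_gt_zero mult_pos_pos) auto
  then show ?thesis
    using False assms(1) by (simp add: mult_neg_neg)
qed

theorem corollary2p4:
  fixes \<mu> :: "'a measure" and p :: "real \<Rightarrow> 'a \<Rightarrow> 'a measure"
    and \<D> :: "('a \<Rightarrow> real) set" and L :: "('a \<Rightarrow> real) \<Rightarrow> 'a \<Rightarrow> real"
    and \<rho> n t :: real and f :: "'a \<Rightarrow> real" and x :: 'a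
  assumes "markov_diffusion_triple \<mu> p \<D> L"
    and "curvature_dimension \<D> L \<rho> n"
    and "\<rho> \<noteq> 0" and "n \<ge> 1"
    and "f \<in> bounded_algebra \<D>" and "\<And>y. f y > 0"
    and "t > 0"
  defines "g \<equiv> semigroup_op p t f"
  shows "4 / (n * \<rho>) * (L g x / g x) < 1 + pi\<^sup>2 / (\<rho>\<^sup>2 * t\<^sup>2) \<and>
    carre_du_champ L g g x / (g x)\<^sup>2 < n / 2 * Phi \<rho> t (4 / (n * \<rho>) * (L g x / g x))"
proof -
  interpret markov_diffusion_triple \<mu> p \<D> L
    by (rule assms(1))
  have n: "0 < n"
    using \<open>n \<ge> 1\<close> by simp
  define X where "X = L g x / g x"
  define z where "z = 4 / (n * \<rho>) * X"
  define l where "l = \<Gamma> g g x / (g x)\<^sup>2"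
  have X: "X = n * \<rho> / 4 * z"
    using n \<open>\<rho> \<noteq> 0\<close> by (simp add: z_def)
  have c: "\<rho>\<^sup>2 - 4 * \<rho> / n * X = \<rho>\<^sup>2 * (1 - z)"
    unfolding X using n by (simp add: field_simps power2_eq_square)
  have comparison: "S' 0 + 2 / n * (l + n * \<rho> / 2 - X) * S 0 < 0"
    if "0 < T" "T \<le> t" "\<And>s. (S has_real_derivative S' s) (at s)"
      "\<And>s. (S' has_real_derivative \<rho>\<^sup>2 * (1 - z) * S s) (at s)"
      "\<And>s. s \<in> {0..T} \<Longrightarrow> 0 \<le> S s" "S T = 0" "0 < S 0 \<or> 0 < S' 0" for T S S'
  proof -
    have "(S' has_real_derivative (\<rho>\<^sup>2 - 4 * \<rho> / n * (L (P t f) x / P t f x)) * S s) (at s)" for s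
      using that(4)[of s] c unfolding X_def g_def by (simp only:)
    from li_yau_comparison[OF assms(5,6,2) n that(1,2,3) this that(5,6,7)]
    show ?thesis
      by (simp only: X_def l_def g_def)
  qed
  have solve: "l < n / 2 * R + X - n * \<rho> / 2" if "2 / n * (l + n * \<rho> / 2 - X) < R" for R
    using that n by (simp add: field_simps)
  have bound: "z < 1 + pi\<^sup>2 / (\<rho>\<^sup>2 * t\<^sup>2)"
  proof (rule ccontr)
    assume "\<not> z < 1 + pi\<^sup>2 / (\<rho>\<^sup>2 * t\<^sup>2)"
    then have z: "pi\<^sup>2 / (\<rho>\<^sup>2 * t\<^sup>2) \<le> z - 1"
      by simp
    (* Otherwise a full arch of sin (k * s) fits into {0..t}. It vanishes at 0 with positive slope, which
       contradicts the comparison whatever the value of l is. *)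
    define k where "k = \<bar>\<rho>\<bar> * sqrt (z - 1)"
    have z1: "0 < z - 1"
      by (rule less_le_trans[OF _ z]) (use \<open>\<rho> \<noteq> 0\<close> \<open>t > 0\<close> in simp)
    then have k: "0 < k" "k\<^sup>2 = \<rho>\<^sup>2 * (z - 1)"
      using \<open>\<rho> \<noteq> 0\<close> by (simp_all add: k_def power_mult_distrib)
    have "(pi / t)\<^sup>2 \<le> k\<^sup>2"
      using z \<open>\<rho> \<noteq> 0\<close> \<open>t > 0\<close> unfolding k(2) by (simp add: power_divide field_simps)
    then have "pi / t \<le> k"
      by (rule power2_le_imp_le) (use k(1) in simp)
    then have T: "pi / k \<le> t"
      using k(1) \<open>t > 0\<close> by (simp add: field_simps)
    have "k * cos (k * 0) + 2 / n * (l + n * \<rho> / 2 - X) * sin (k * 0) < 0"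
    proof (rule comparison[OF _ T, where S' = "\<lambda>s. k * cos (k * s)"])
      show "((\<lambda>s. sin (k * s)) has_real_derivative k * cos (k * s)) (at s)" for s
        by (auto intro!: derivative_eq_intros)
      have c': "\<rho>\<^sup>2 * (1 - z) = - k\<^sup>2"
        unfolding k(2) by (simp add: algebra_simps)
      show "((\<lambda>s. k * cos (k * s)) has_real_derivative \<rho>\<^sup>2 * (1 - z) * sin (k * s)) (at s)" for s
        unfolding c' by (auto intro!: derivative_eq_intros simp: power2_eq_square)
      show "0 \<le> sin (k * s)" if "s \<in> {0..pi / k}" for s
        using that k(1) by (intro sin_ge_zero) (auto simp: field_simps)
    qed (use k(1) in auto)
    with k(1) show False
      by simp
  qed
  have "l < n / 2 * Phi \<rho> t z"
  proof (cases z "1 :: real" rule: linorder_cases)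
    case less
    define \<kappa> where "\<kappa> = \<rho> * sqrt (1 - z)"
    have \<kappa>: "\<kappa> \<noteq> 0" "\<kappa>\<^sup>2 = \<rho>\<^sup>2 * (1 - z)"
      using \<open>\<rho> \<noteq> 0\<close> less by (simp_all add: \<kappa>_def power_mult_distrib)
    have "- (\<kappa>\<^sup>2 * cosh (\<kappa> * (t - 0))) + 2 / n * (l + n * \<rho> / 2 - X) * (\<kappa> * sinh (\<kappa> * (t - 0))) < 0"
    proof (rule comparison[OF \<open>t > 0\<close> order_refl, where S' = "\<lambda>s. - (\<kappa>\<^sup>2 * cosh (\<kappa> * (t - s)))"])
      show "((\<lambda>s. \<kappa> * sinh (\<kappa> * (t - s))) has_real_derivative - (\<kappa>\<^sup>2 * cosh (\<kappa> * (t - s)))) (at s)" for s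
        by (auto intro!: derivative_eq_intros simp: power2_eq_square)
      show "((\<lambda>s. - (\<kappa>\<^sup>2 * cosh (\<kappa> * (t - s)))) has_real_derivative
          \<rho>\<^sup>2 * (1 - z) * (\<kappa> * sinh (\<kappa> * (t - s)))) (at s)" for s
        unfolding \<kappa>(2)[symmetric] by (auto intro!: derivative_eq_intros)
      show "0 \<le> \<kappa> * sinh (\<kappa> * (t - s))" if "s \<in> {0..t}" for s
        using mult_sinh_pos[OF \<kappa>(1), of "t - s"] that by (cases "s = t") auto
    qed (use mult_sinh_pos[OF \<kappa>(1) \<open>t > 0\<close>] in auto)
    then have "2 / n * (l + n * \<rho> / 2 - X) < \<kappa> * (cosh (\<kappa> * t) / sinh (\<kappa> * t))"
      using mult_sinh_pos[OF \<kappa>(1) \<open>t > 0\<close>] by (intro divide_square_scale) simp_all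
    then have "l < n / 2 * (\<kappa> * coth (\<kappa> * t)) + X - n * \<rho> / 2"
      unfolding coth_def by (rule solve)
    then show ?thesis
      using less unfolding X by (simp add: Phi_def \<kappa>_def mult.commute mult.left_commute algebra_simps)
  next
    case equal
    have "- 1 + 2 / n * (l + n * \<rho> / 2 - X) * (t - 0) < 0"
      by (rule comparison[OF \<open>t > 0\<close> order_refl, where S' = "\<lambda>s. - 1"])
        (use equal \<open>t > 0\<close> in \<open>auto intro!: derivative_eq_intros\<close>)
    then have "2 / n * (l + n * \<rho> / 2 - X) < 1 / t"
      using \<open>t > 0\<close> by (simp add: field_simps)
    then have "l < n / 2 * (1 / t) + X - n * \<rho> / 2"
      by (rule solve)
    then show ?thesis
      using equal unfolding X by (simp add: Phi_def right_diff_distrib mult.commute)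
  next
    case greater
    define \<kappa> where "\<kappa> = \<rho> * sqrt (z - 1)"
    have \<kappa>: "\<kappa> \<noteq> 0" "\<kappa>\<^sup>2 = \<rho>\<^sup>2 * (z - 1)"
      using \<open>\<rho> \<noteq> 0\<close> greater by (simp_all add: \<kappa>_def power_mult_distrib)
    have "(\<bar>\<kappa>\<bar> * t)\<^sup>2 < pi\<^sup>2"
      using bound \<open>\<rho> \<noteq> 0\<close> \<open>t > 0\<close> by (simp add: power_mult_distrib \<kappa>(2) field_simps)
    then have small: "\<bar>\<kappa>\<bar> * t < pi"
      by (rule power2_less_imp_less) simp
    have pos: "0 < \<kappa> * sin (\<kappa> * a)" if "0 < a" "a \<le> t" for a
      using that mult_left_mono[OF that(2), of "\<bar>\<kappa>\<bar>"] small by (intro mult_sin_pos \<kappa>(1)) auto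
    have "- (\<kappa>\<^sup>2 * cos (\<kappa> * (t - 0))) + 2 / n * (l + n * \<rho> / 2 - X) * (\<kappa> * sin (\<kappa> * (t - 0))) < 0"
    proof (rule comparison[OF \<open>t > 0\<close> order_refl, where S' = "\<lambda>s. - (\<kappa>\<^sup>2 * cos (\<kappa> * (t - s)))"])
      show "((\<lambda>s. \<kappa> * sin (\<kappa> * (t - s))) has_real_derivative - (\<kappa>\<^sup>2 * cos (\<kappa> * (t - s)))) (at s)" for s
        by (auto intro!: derivative_eq_intros simp: power2_eq_square)
      have c': "\<rho>\<^sup>2 * (1 - z) = - \<kappa>\<^sup>2"
        unfolding \<kappa>(2) by (simp add: algebra_simps)
      show "((\<lambda>s. - (\<kappa>\<^sup>2 * cos (\<kappa> * (t - s)))) has_real_derivative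
          \<rho>\<^sup>2 * (1 - z) * (\<kappa> * sin (\<kappa> * (t - s)))) (at s)" for s
        unfolding c' by (auto intro!: derivative_eq_intros)
      show "0 \<le> \<kappa> * sin (\<kappa> * (t - s))" if "s \<in> {0..t}" for s
        using pos[of "t - s"] that by (cases "s = t") auto
    qed (use pos[OF \<open>t > 0\<close>] in auto)
    then have "2 / n * (l + n * \<rho> / 2 - X) < \<kappa> * (cos (\<kappa> * t) / sin (\<kappa> * t))"
      using pos[OF \<open>t > 0\<close>] by (intro divide_square_scale) simp_all
    then have "l < n / 2 * (\<kappa> * cot (\<kappa> * t)) + X - n * \<rho> / 2"
      unfolding cot_def by (rule solve)
    then show ?thesis
      using greater unfolding X by (simp add: Phi_def \<kappa>_def mult.commute mult.left_commute algebra_simps)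
  qed
  with bound show ?thesis
    by (simp add: z_def X_def l_def)
qed

end
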